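(* Fix partitions $\mu,\nu$. For each integer $k\ge0$ let $\Phi(\mu,\nu,k)$ be the partition with 2-quotient $(\mu,\nu)$ and 2-core $(k,k-1,\dots,1)$. Then for every $0\le j\le|\mu|+|\nu|$ there is a polynomial $P_j$ of degree at most $j$ such that the coefficient $r_{\Phi(\mu,\nu,k),j}$ equals $P_j(k)$ for all integers $k\ge0$.
   Context: Partitions $\lambda=(\lambda_1\ge\dots\ge\lambda_{\ell(\lambda)}>0)$, degree vector $n_i=\lambda_i+\ell(\lambda)-i$, $\Delta(n_\lambda)=\prod_{i<j}(n_j-n_i)$. Hermite: $\mathrm{He}_0=1,\mathrm{He}_1=x,\mathrm{He}_n=x\mathrm{He}_{n-1}-(n-1)\mathrm{He}_{n-2}$; $\mathrm{He}_\lambda=\mathrm{Wr}[\mathrm{He}_{n_1},\dots,\mathrm{He}_{n_{\ell(\lambda)}}]/\Delta(n_\lambda)$. Maya diagram: a set $M\subset\mathbb{Z}$ containing all sufficiently negative integers and finitely many non-negative ones; $\lambda(M)$ has parts the positive values of $\#\{n\notin M:n<m\}$, $m\in M$. $M_\lambda=\{n<0\}\cup\{n_i\}$, $M_\lambda+t=\{m+t:m\in M_\lambda\}$. For partitions $\mu,\nu$ and $k\in\mathbb{Z}$ choose $s,s'\ge0$ with $\ell(\nu)+s'-\ell(\mu)-s=k$ and set $\Phi(\mu,\nu,k)=\lambda(\{2m:m\in M_\mu+s\}\cup\{2m+1:m\in M_\nu+s'\})$. For $k\ge0$, $(\mu,\nu)$ is the 2-quotient and $(k,\dots,1)$ the 2-core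 of $\Phi(\mu,\nu,k)$. For $\lambda$ with 2-core $\bar\lambda$ and 2-quotient $(\mu,\nu)$ there is a monic polynomial $R_\lambda$ of degree $|\mu|+|\nu|$ with $\mathrm{He}_\lambda(x)=x^{|\bar\lambda|}R_\lambda(x^2)$, and $R_\lambda(x)=\sum_{j=0}^{|\mu|+|\nu|}r_{\lambda,j}x^{|\mu|+|\nu|-j}$. *)

theory Defs
  imports "HOL-Computational_Algebra.Polynomial" "HOL-Combinatorics.Permutations"
begin

(* A partition is a list (lambda_1 >= ... >= lambda_l > 0); the list index i
   (0-based) corresponds to lambda_{i+1}. *)
definition is_partition :: "nat list \<Rightarrow> bool" where
  "is_partition lam \<longleftrightarrow> sorted (rev lam) \<and> (\<forall>x \<in> set lam. 0 < x)"

definition psize :: "nat list \<Rightarrow> nat" where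
  "psize lam = sum_list lam"

(* degree vector: n_i = lambda_i + l - i  (1-based i), here with 0-based index *)
definition degvec :: "nat list \<Rightarrow> nat \<Rightarrow> nat" where
  "degvec lam i = lam ! i + length lam - 1 - i"

definition Delta :: "nat list \<Rightarrow> int" where
  "Delta lam = (\<Prod>j<length lam. \<Prod>i<j. int (degvec lam j) - int (degvec lam i))"

fun He :: "nat \<Rightarrow> real poly" where
  "He 0 = 1"
| "He (Suc 0) = [:0, 1:]"
| "He (Suc (Suc n)) = [:0, 1:] * He (Suc n) - smult (real (Suc n)) (He n)"

definition wronskian :: "real poly list \<Rightarrow> real poly" where
  "wronskian fs = (\<Sum>p | p permutes {..<length fs}.
      of_int (sign p) * (\<Prod>j<length fs. (pderiv ^^ p j) (fs ! j)))"

definition He_part :: "nat list \<Rightarrow> real poly" where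
  "He_part lam = smult (1 / real_of_int (Delta lam))
      (wronskian (map (\<lambda>i. He (degvec lam i)) [0..<length lam]))"

definition maya_of :: "nat list \<Rightarrow> int set" where
  "maya_of lam = {n. n < 0} \<union> {int (degvec lam i) | i. i < length lam}"

definition shift_set :: "int set \<Rightarrow> int \<Rightarrow> int set" where
  "shift_set M t = {m + t | m. m \<in> M}"

definition maya_h :: "int set \<Rightarrow> int \<Rightarrow> nat" where
  "maya_h M m = card {n. n \<notin> M \<and> n < m}"

definition part_of_maya :: "int set \<Rightarrow> nat list" where
  "part_of_maya M = rev (map (maya_h M) (sorted_list_of_set {m \<in> M. 0 < maya_h M m}))"

(* Phi(mu,nu,k), with the admissible choice s = l(nu) + max(-k,0), s' = l(mu) + max(k,0),
   so that l(nu) + s' - l(mu) - s = k and s, s' >= 0 *)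
definition Phi :: "nat list \<Rightarrow> nat list \<Rightarrow> int \<Rightarrow> nat list" where
  "Phi mu nu k =
    (let s = int (length nu) + int (nat (- k)); s' = int (length mu) + int (nat k) in
     part_of_maya ({2 * m | m. m \<in> shift_set (maya_of mu) s}
                 \<union> {2 * m + 1 | m. m \<in> shift_set (maya_of nu) s'}))"

(* R_lambda for lambda = Phi(mu,nu,k), k >= 0: the 2-core is (k,...,1) of size k(k+1)/2,
   and R_lambda is the polynomial with He_lambda(x) = x^{k(k+1)/2} R_lambda(x^2). *)
definition R_Phi :: "nat list \<Rightarrow> nat list \<Rightarrow> nat \<Rightarrow> real poly" where
  "R_Phi mu nu k = (THE R. He_part (Phi mu nu (int k)) =
      monom 1 (k * (k + 1) div 2) * pcompose R [:0, 0, 1:])"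

definition r_Phi :: "nat list \<Rightarrow> nat list \<Rightarrow> nat \<Rightarrow> nat \<Rightarrow> real" where
  "r_Phi mu nu k j = coeff (R_Phi mu nu k) (psize mu + psize nu - j)"

end

theory Submission
  imports Defs "Jordan_Normal_Form.Determinant"
begin

text \<open>
  Since \<open>x He_n' = n He_n + n (n - 1) He_(n-2)\<close>, applying the Euler operator to a Wronskian of
  Hermite polynomials expresses each coefficient through Wronskians in which one degree is lowered
  by 2. Divided by the Vandermonde product of the degrees, the \<open>j\<close>-th coefficient becomes a
  \<open>j\<close>-fold sum over steps \<open>u \<rightarrow> u - 1\<close> on the set of halved degrees, with weight a multiple
  of \<open>u (u - 1/2)\<close> times a ratio of Vandermonde products. An element of the set that is a root
  of the quadratic weight can be deleted if the root is increased by 1. Deleting in this way the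
  even and the odd initial segments of the Maya diagram of \<open>\<Phi>(\<mu>, \<nu>, k)\<close> leaves the set
  \<open>A \<union> (c + B)\<close> and the weight \<open>u (u - c)\<close>, where \<open>A\<close>, \<open>B\<close> are the degree sets of
  \<open>\<mu>\<close>, \<open>\<nu>\<close> and \<open>c = k + 1/2 + \<ell>(\<mu>) - \<ell>(\<nu>)\<close>.

  The resulting function is polynomial in \<open>c\<close>, because it lies in the algebra generated by \<open>c\<close>
  and the moments \<open>\<Sum>u\<^sup>r w(u)\<close> of the weights \<open>w(u) = \<Prod>(u - 1 - v) / (u - v)\<close>, and these
  moments obey a recursion without denominators when a point is added. Its degree is at most \<open>j\<close>:
  for half-integral \<open>c\<close> distinct points have distance at least \<open>1/2\<close>, so that \<open>w\<close> is bounded and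
  each of the \<open>j\<close> steps contributes a factor \<open>O(c)\<close>.
\<close>

hide_const (open) Module.smult

subsection \<open>Weighted descent on finite sets of reals\<close>

(* The factor by which a Vandermonde product over X changes when its element u is replaced
   by u - 1; it vanishes when u - 1 already belongs to X. *)
definition shift_wt :: "real set \<Rightarrow> real \<Rightarrow> real" where
  "shift_wt X u = (\<Prod>v\<in>X - {u}. (u - 1 - v) / (u - v))"

(* For X the set of halved degrees, a = 0 and c = 1/2, this is the j-th coefficient of the
   normalised Wronskian: the step u -> u - 1 comes from He_n -> He_(n-2), and
   -2 u (u - 1/2) = - n (n - 1) / 2 for n = 2 u. *)
fun descent :: "real \<Rightarrow> real \<Rightarrow> nat \<Rightarrow> real set \<Rightarrow> real" where
  "descent a c 0 X = 1"
| "descent a c (Suc j) X = - 2 / real (Suc j) *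
     (\<Sum>u\<in>X. (u - a) * (u - c) * shift_wt X u * descent a c j (insert (u - 1) (X - {u})))"

lemma shift_wt_eq_0: "finite X \<Longrightarrow> u - 1 \<in> X \<Longrightarrow> shift_wt X u = 0"
  by (auto simp: shift_wt_def intro!: bexI[of _ "u - 1"])

lemma shift_wt_insert:
  assumes "finite X" "w \<notin> X" "u \<noteq> w"
  shows "shift_wt (insert w X) u = (u - 1 - w) / (u - w) * shift_wt X u"
proof -
  have "insert w X - {u} = insert w (X - {u})" using assms by auto
  then show ?thesis using assms by (simp add: shift_wt_def)
qed

lemma shift_wt_insert_self:
  "w \<notin> X \<Longrightarrow> shift_wt (insert w X) w = (\<Prod>v\<in>X. (w - 1 - v) / (w - v))"
  by (simp add: shift_wt_def)

lemma descent_commute: "descent a c j X = descent c a j X"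
  by (induction j arbitrary: X) (simp_all add: mult.commute mult.left_commute)

(* The factor (u - 1 - a) / (u - a) contributed by the element a cancels the root a of the weight
   and creates the root a + 1. *)
lemma descent_insert_root:
  "finite Y \<Longrightarrow> a \<notin> Y \<Longrightarrow> descent a c j (insert a Y) = descent (a + 1) c j Y"
proof (induction j arbitrary: Y)
  case (Suc j)
  have "(u - a) * (u - c) * shift_wt (insert a Y) u
          * descent a c j (insert (u - 1) (insert a Y - {u}))
      = (u - (a + 1)) * (u - c) * shift_wt Y u * descent (a + 1) c j (insert (u - 1) (Y - {u}))"
    if "u \<in> Y" for u
  \<comment> \<open>For \<open>u = a + 1\<close> the moved point lands on \<open>a\<close>, which is
    then not fresh for the induction hypothesis. Both sides are zero instead: on the left by
    collision with \<open>a\<close>, on the right through the factor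
    \<open>u - (a + 1)\<close>.\<close>
  proof (cases "u = a + 1")
    case True
    then show ?thesis using Suc.prems that by (simp add: shift_wt_eq_0)
  next
    case False
    have ua: "u \<noteq> a" using that Suc.prems by auto
    have "insert (u - 1) (insert a Y - {u}) = insert a (insert (u - 1) (Y - {u}))"
      using ua by auto
    moreover have "descent a c j (insert a (insert (u - 1) (Y - {u})))
        = descent (a + 1) c j (insert (u - 1) (Y - {u}))"
      using Suc.prems False by (intro Suc.IH) auto
    ultimately show ?thesis
      using ua Suc.prems by (simp add: shift_wt_insert) 
  qed
  then have "(\<Sum>u\<in>Y. (u - a) * (u - c) * shift_wt (insert a Y) u
          * descent a c j (insert (u - 1) (insert a Y - {u})))
     = (\<Sum>u\<in>Y. (u - (a + 1)) * (u - c) * shift_wt Y u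
          * descent (a + 1) c j (insert (u - 1) (Y - {u})))"
    by (rule sum.cong[OF refl])
  \<comment> \<open>The one summand left over, \<open>u = a\<close>, carries the factor
    \<open>u - a = 0\<close>.\<close>
  then show ?case using Suc.prems by simp
qed simp

text \<open>Deleting the root \<open>a\<close> moves it to \<open>a + 1\<close>, the next element of
  the progression, so the progression is removed one element at a time from the bottom.\<close>

lemma descent_strip:
  assumes "finite Y" "Y \<inter> (\<lambda>i. a + real i) ` {..<s} = {}"
  shows "descent a c j ((\<lambda>i. a + real i) ` {..<s} \<union> Y) = descent (a + real s) c j Y"
  using assms
proof (induction s arbitrary: Y)
  case (Suc s)
  have "(\<lambda>i. a + real i) ` {..<Suc s} \<union> Y
      = (\<lambda>i. a + real i) ` {..<s} \<union> insert (a + real s) Y"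
    by (auto simp: lessThan_Suc)
  also have "descent a c j \<dots> = descent (a + real s) c j (insert (a + real s) Y)"
    using Suc.prems by (intro Suc.IH) auto
  also have "\<dots> = descent (a + real s + 1) c j Y"
    using Suc.prems by (intro descent_insert_root) auto
  finally show ?case by (simp add: algebra_simps)
qed simp

lemma shift_wt_translate: "shift_wt ((\<lambda>x. x + t) ` X) (u + t) = shift_wt X u"
proof -
  have "(\<lambda>x. x + t) ` X - {u + t} = (\<lambda>x. x + t) ` (X - {u})" by auto
  then show ?thesis
    by (simp add: shift_wt_def prod.reindex algebra_simps)
qed

lemma descent_translate:
  "descent (a + t) (c + t) j ((\<lambda>x. x + t) ` X) = descent a c j X"
proof (induction j arbitrary: X)
  case (Suc j)
  have "insert (u + t - 1) ((\<lambda>x. x + t) ` X - {u + t}) = (\<lambda>x. x + t) ` insert (u - 1) (X - {u})"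
    for u by auto
  then show ?case
    by (simp add: sum.reindex shift_wt_translate Suc.IH del: image_insert)
qed simp

section \<open>Moments of the shift weights and the algebra they generate\<close>

text \<open>Partial fractions in \<open>w\<close>: the product tends to 1 at infinity and has simple
  poles at the points \<open>u\<close> of \<open>X\<close>, with residue
  \<open>- shift_wt X u\<close>.\<close>

lemma prod_shift_partial_fractions:
  assumes "finite X" "w \<notin> X"
  shows "(\<Prod>v\<in>X. (w - 1 - v) / (w - v)) = 1 - (\<Sum>u\<in>X. shift_wt X u / (w - u))"
  using assms
proof (induction X arbitrary: w rule: finite_induct)
  case (insert x X)
  have wx: "w \<noteq> x" "w \<notin> X" using insert.prems by auto
  \<comment> \<open>The new factor is \<open>1 - 1 / (u - x)\<close>, and
    \<open>1 / ((u - x) * (w - u))\<close> splits into \<open>1 / (w - x)\<close> times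
    \<open>1 / (u - x) + 1 / (w - u)\<close>.\<close>
  have "shift_wt (insert x X) u / (w - u)
      = shift_wt X u / (w - u) - 1 / (w - x) * (shift_wt X u / (w - u)) + 1 / (w - x) * (shift_wt X u / (x - u))"
    if "u \<in> X" for u
  proof -
    have u: "u \<noteq> x" "w \<noteq> u" using that insert.hyps wx by auto
    show ?thesis
      using u wx insert.hyps by (simp add: shift_wt_insert divide_simps) (simp add: algebra_simps)
  qed
  then have "(\<Sum>u\<in>X. shift_wt (insert x X) u / (w - u))
     = (\<Sum>u\<in>X. shift_wt X u / (w - u)) - 1 / (w - x) * (\<Sum>u\<in>X. shift_wt X u / (w - u))
       + 1 / (w - x) * (\<Sum>u\<in>X. shift_wt X u / (x - u))"
    by (simp add: sum.distrib sum_subtractf sum_distrib_left)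
  \<comment> \<open>The induction hypothesis at \<open>w = x\<close> evaluates the weight of the new
    point; its sum cancels the last sum of the previous equation.\<close>
  moreover have "shift_wt (insert x X) x / (w - x) = 1 / (w - x) - 1 / (w - x) * (\<Sum>u\<in>X. shift_wt X u / (x - u))"
    using insert by (simp add: shift_wt_insert_self diff_divide_distrib)
  ultimately have "1 - (\<Sum>u\<in>insert x X. shift_wt (insert x X) u / (w - u))
     = (1 - 1 / (w - x)) * (1 - (\<Sum>u\<in>X. shift_wt X u / (w - u)))"
    unfolding sum.insert[OF insert.hyps(1,2)] by (simp add: algebra_simps add_divide_distrib diff_divide_distrib)
  also have "1 - 1 / (w - x) = (w - 1 - x) / (w - x)"
    using wx by (simp add: divide_simps)
  finally show ?case
    using insert.hyps wx insert.IH[of w] by simp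
qed simp

definition shift_moment :: "nat \<Rightarrow> real set \<Rightarrow> real" where
  "shift_moment r X = (\<Sum>u\<in>X. u ^ r * shift_wt X u)"

text \<open>Each old weight acquires the factor \<open>1 - 1 / (u - w)\<close>, and the weight of
  \<open>w\<close> expands into partial fractions. Together the fractions form
  \<open>(u ^ r - w ^ r) / (u - w)\<close>, which is a polynomial in \<open>u\<close> and
  \<open>w\<close>, so no denominator survives.\<close>

lemma shift_moment_insert:
  assumes "finite X" "w \<notin> X"
  shows "shift_moment r (insert w X)
    = shift_moment r X + w ^ r - (\<Sum>i<r. w ^ (r - Suc i) * shift_moment i X)"
proof -
  have *: "u ^ r * shift_wt (insert w X) u + w ^ r * (shift_wt X u / (u - w))
      = u ^ r * shift_wt X u - (\<Sum>i<r. w ^ (r - Suc i) * (u ^ i * shift_wt X u))" if "u \<in> X" for u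
  proof -
    have uw: "u \<noteq> w" using that assms by auto
    have "(\<Sum>i<r. w ^ (r - Suc i) * (u ^ i * shift_wt X u))
      = (\<Sum>i<r. w ^ (r - Suc i) * u ^ i) * shift_wt X u"
      by (simp add: sum_distrib_right mult.assoc)
    also have "(\<Sum>i<r. w ^ (r - Suc i) * u ^ i) = (u ^ r - w ^ r) / (u - w)"
      using uw by (simp add: power_diff_sumr2)
    finally have "(\<Sum>i<r. w ^ (r - Suc i) * (u ^ i * shift_wt X u))
        = (u ^ r - w ^ r) / (u - w) * shift_wt X u" .
    moreover have "u ^ r * ((u - 1 - w) / (u - w)) + w ^ r / (u - w)
         = u ^ r - (u ^ r - w ^ r) / (u - w)"
      using uw by (simp add: divide_simps) (simp add: algebra_simps)
    then have "(u ^ r * ((u - 1 - w) / (u - w)) + w ^ r / (u - w)) * shift_wt X u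
         = (u ^ r - (u ^ r - w ^ r) / (u - w)) * shift_wt X u" by simp
    ultimately show ?thesis
      using uw assms by (simp add: shift_wt_insert algebra_simps)
  qed
  have neg: "shift_wt X u / (w - u) = - (shift_wt X u / (u - w))" for u
    by (metis minus_diff_eq minus_divide_right)
  have "shift_moment r (insert w X)
      = w ^ r * (1 - (\<Sum>u\<in>X. shift_wt X u / (w - u))) + (\<Sum>u\<in>X. u ^ r * shift_wt (insert w X) u)"
    using assms by (simp add: shift_moment_def shift_wt_insert_self prod_shift_partial_fractions)
  also have "\<dots> = w ^ r
      + (\<Sum>u\<in>X. u ^ r * shift_wt (insert w X) u + w ^ r * (shift_wt X u / (u - w)))"
    by (simp add: neg sum_negf sum.distrib sum_distrib_left algebra_simps)
  also have "(\<Sum>u\<in>X. u ^ r * shift_wt (insert w X) u + w ^ r * (shift_wt X u / (u - w)))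
     = shift_moment r X - (\<Sum>u\<in>X. \<Sum>i<r. w ^ (r - Suc i) * (u ^ i * shift_wt X u))"
    using * by (simp add: shift_moment_def sum_subtractf)
  also have "(\<Sum>u\<in>X. \<Sum>i<r. w ^ (r - Suc i) * (u ^ i * shift_wt X u))
     = (\<Sum>i<r. w ^ (r - Suc i) * shift_moment i X)"
    by (subst sum.swap) (simp add: shift_moment_def sum_distrib_left)
  finally show ?thesis by simp
qed

(* Each summand of descent has poles where two elements of X collide; the moments do not, by
   shift_moment_insert. *)
inductive moment_alg :: "(real \<Rightarrow> real set \<Rightarrow> real) \<Rightarrow> bool" where
  const: "moment_alg (\<lambda>c X. r)"
| param: "moment_alg (\<lambda>c X. c)"
| moment: "moment_alg (\<lambda>c X. shift_moment r X)"
| add: "moment_alg f \<Longrightarrow> moment_alg g \<Longrightarrow> moment_alg (\<lambda>c X. f c X + g c X)"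
| mult: "moment_alg f \<Longrightarrow> moment_alg g \<Longrightarrow> moment_alg (\<lambda>c X. f c X * g c X)"

text \<open>Polynomials in a marked point \<open>u\<close> with coefficients in the moment algebra:
  the shape of a summand of \<open>descent\<close> once its weight is split off.\<close>

inductive pointed_alg :: "(real \<Rightarrow> real set \<Rightarrow> real \<Rightarrow> real) \<Rightarrow> bool" where
  monomial: "moment_alg f \<Longrightarrow> pointed_alg (\<lambda>c X u. f c X * u ^ i)"
| add: "pointed_alg g \<Longrightarrow> pointed_alg h \<Longrightarrow> pointed_alg (\<lambda>c X u. g c X u + h c X u)"

lemma pointed_alg_base: "moment_alg f \<Longrightarrow> pointed_alg (\<lambda>c X u. f c X)"
  using pointed_alg.monomial[of f 0] by simp

lemma pointed_alg_point: "pointed_alg (\<lambda>c X u. u)"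
  using pointed_alg.monomial[OF moment_alg.const, of 1 1] by simp

lemma pointed_alg_mult:
  assumes "pointed_alg g" "pointed_alg h"
  shows "pointed_alg (\<lambda>c X u. g c X u * h c X u)"
  using assms(1)
proof (induction rule: pointed_alg.induct)
  case (monomial f i)
  show ?case using assms(2)
  proof (induction rule: pointed_alg.induct)
    case (monomial f' i')
    have "pointed_alg (\<lambda>c X u. (f c X * f' c X) * u ^ (i + i'))"
      by (intro pointed_alg.monomial moment_alg.mult monomial \<open>moment_alg f\<close>)
    then show ?case by (simp add: power_add mult_ac)
  next
    case (add g h)
    then show ?case using pointed_alg.add[OF add.IH] by (simp add: distrib_left)
  qed
next
  case (add g g')
  then show ?case using pointed_alg.add[OF add.IH] by (simp add: distrib_right)
qed

lemmas pointed_alg_const = pointed_alg_base[OF moment_alg.const]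

lemma pointed_alg_diff:
  assumes "pointed_alg g" "pointed_alg h"
  shows "pointed_alg (\<lambda>c X u. g c X u - h c X u)"
  using pointed_alg.add[OF assms(1) pointed_alg_mult[OF pointed_alg_const[of "- 1"] assms(2)]]
  by simp

lemma pointed_alg_power: "pointed_alg g \<Longrightarrow> pointed_alg (\<lambda>c X u. g c X u ^ i)"
  by (induction i) (auto intro: pointed_alg_mult pointed_alg_const)

lemma pointed_alg_sum:
  "(\<And>i::nat. i < n \<Longrightarrow> pointed_alg (h i)) \<Longrightarrow> pointed_alg (\<lambda>c X u. \<Sum>i<n. h i c X u)"
  by (induction n) (auto intro: pointed_alg.add pointed_alg_const)

text \<open>Summing \<open>u ^ i\<close> against the weights gives the \<open>i\<close>-th moment,
  so the sum over the marked point falls back into the moment algebra.\<close>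

lemma pointed_alg_shift_sum:
  assumes "pointed_alg h"
  shows "\<exists>f. moment_alg f \<and> (\<forall>c X. finite X \<longrightarrow> (\<Sum>u\<in>X. shift_wt X u * h c X u) = f c X)"
  using assms
proof (induction rule: pointed_alg.induct)
  case (monomial f i)
  have "moment_alg (\<lambda>c X. f c X * shift_moment i X)"
    by (intro moment_alg.mult moment_alg.moment monomial)
  moreover have "(\<Sum>u\<in>X. shift_wt X u * (f c X * u ^ i)) = f c X * shift_moment i X" for c X
    by (simp add: shift_moment_def sum_distrib_left mult_ac)
  ultimately show ?case by blast
next
  case (add g h)
  then obtain f f' where "moment_alg f" "moment_alg f'"
    "\<And>c X. finite X \<Longrightarrow> (\<Sum>u\<in>X. shift_wt X u * g c X u) = f c X"
    "\<And>c X. finite X \<Longrightarrow> (\<Sum>u\<in>X. shift_wt X u * h c X u) = f' c X" by blast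
  then show ?case
    by (intro exI[of _ "\<lambda>c X. f c X + f' c X"])
       (auto intro: moment_alg.add simp: distrib_left sum.distrib)
qed

text \<open>The insertion formula read backwards: it expresses the \<open>r\<close>-th moment of
  \<open>X - {u}\<close> by that of \<open>X\<close> and by lower moments of \<open>X - {u}\<close>,
  which are known by strong induction.\<close>

lemma shift_moment_delete:
  "\<exists>h. pointed_alg h \<and> (\<forall>c X u. finite X \<longrightarrow> u \<in> X \<longrightarrow> shift_moment r (X - {u}) = h c X u)"
proof (induction r rule: less_induct)
  case (less r)
  then have "\<forall>i. \<exists>h. i < r \<longrightarrow> pointed_alg h \<and>
      (\<forall>c X u. finite X \<longrightarrow> u \<in> X \<longrightarrow> shift_moment i (X - {u}) = h c X u)" by blast
  from choice[OF this] obtain h where h: "\<forall>i<r. pointed_alg (h i) \<and>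
      (\<forall>c X u. finite X \<longrightarrow> u \<in> X \<longrightarrow> shift_moment i (X - {u}) = h i c X u)" ..
  let ?h = "\<lambda>c X u. shift_moment r X - u ^ r + (\<Sum>i<r. u ^ (r - Suc i) * h i c X u)"
  have "pointed_alg ?h"
    by (intro pointed_alg.add pointed_alg_diff pointed_alg_sum pointed_alg_mult pointed_alg_power
        pointed_alg_point pointed_alg_base moment_alg.moment) (use h in simp)
  moreover have "shift_moment r (X - {u}) = ?h c X u" if "finite X" "u \<in> X" for c X u
    using shift_moment_insert[of "X - {u}" u r] that h
    by (simp add: insert_absorb)
  ultimately show ?case by blast
qed

text \<open>Moving \<open>u\<close> to \<open>u - 1\<close> is a deletion followed by an insertion,
  and both act on moments without denominators. The insertion formula requires \<open>u - 1\<close>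
  to be a new point.\<close>

lemma moment_alg_shift_point:
  assumes "moment_alg f"
  shows "\<exists>h. pointed_alg h \<and> (\<forall>c X u. finite X \<longrightarrow> u \<in> X \<longrightarrow> u - 1 \<notin> X
           \<longrightarrow> f c (insert (u - 1) (X - {u})) = h c X u)"
  using assms
proof (induction rule: moment_alg.induct)
  case (moment r)
  have "\<forall>i. \<exists>h. pointed_alg h \<and>
      (\<forall>c X u. finite X \<longrightarrow> u \<in> X \<longrightarrow> shift_moment i (X - {u}) = h c X u)"
    using shift_moment_delete by blast
  from choice[OF this] obtain h where h: "\<forall>i. pointed_alg (h i) \<and>
      (\<forall>c X u. finite X \<longrightarrow> u \<in> X \<longrightarrow> shift_moment i (X - {u}) = h i c X u)" ..
  let ?h = "\<lambda>c X u. h r c X u + (u - 1) ^ r - (\<Sum>i<r. (u - 1) ^ (r - Suc i) * h i c X u)"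
  have "pointed_alg ?h"
    by (intro pointed_alg.add pointed_alg_diff pointed_alg_sum pointed_alg_mult pointed_alg_power
        pointed_alg_point pointed_alg_const) (use h in simp_all)
  moreover have "shift_moment r (insert (u - 1) (X - {u})) = ?h c X u"
    if "finite X" "u \<in> X" "u - 1 \<notin> X" for c X u
    using shift_moment_insert[of "X - {u}" "u - 1" r] that h by simp
  ultimately show ?case by blast
next
  case (const r)
  show ?case using pointed_alg_const by blast
next
  case param
  show ?case using pointed_alg_base[OF moment_alg.param] by blast
next
  case (add f g)
  from add.IH(1) obtain h where h: "pointed_alg h \<and> (\<forall>c X u. finite X \<longrightarrow> u \<in> X \<longrightarrow> u - 1 \<notin> X
    \<longrightarrow> f c (insert (u - 1) (X - {u})) = h c X u)" ..
  from add.IH(2) obtain h' where h': "pointed_alg h' \<and> (\<forall>c X u. finite X \<longrightarrow> u \<in> X \<longrightarrow> u - 1 \<notin> X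
    \<longrightarrow> g c (insert (u - 1) (X - {u})) = h' c X u)" ..
  show ?case
    using pointed_alg.add[of h h'] h h' by (intro exI[of _ "\<lambda>c X u. h c X u + h' c X u"]) simp
next
  case (mult f g)
  from mult.IH(1) obtain h where h: "pointed_alg h \<and> (\<forall>c X u. finite X \<longrightarrow> u \<in> X \<longrightarrow> u - 1 \<notin> X
    \<longrightarrow> f c (insert (u - 1) (X - {u})) = h c X u)" ..
  from mult.IH(2) obtain h' where h': "pointed_alg h' \<and> (\<forall>c X u. finite X \<longrightarrow> u \<in> X \<longrightarrow> u - 1 \<notin> X
    \<longrightarrow> g c (insert (u - 1) (X - {u})) = h' c X u)" ..
  show ?case
    using pointed_alg_mult[of h h'] h h' by (intro exI[of _ "\<lambda>c X u. h c X u * h' c X u"]) simp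
qed

lemma descent_moment_alg:
  "\<exists>f. moment_alg f \<and> (\<forall>c X. finite X \<longrightarrow> descent 0 c j X = f c X)"
proof (induction j)
  case 0
  show ?case using moment_alg.const[of 1] by auto
next
  case (Suc j)
  then obtain f where f: "moment_alg f" "\<And>c X. finite X \<Longrightarrow> descent 0 c j X = f c X" by blast
  from moment_alg_shift_point[OF f(1)] obtain h where h: "pointed_alg h"
    "\<And>c X u. finite X \<Longrightarrow> u \<in> X \<Longrightarrow> u - 1 \<notin> X \<Longrightarrow> f c (insert (u - 1) (X - {u})) = h c X u"
    by blast
  have "pointed_alg (\<lambda>c X u. u * (u - c) * h c X u)"
    by (intro pointed_alg_mult pointed_alg_diff pointed_alg_point h
        pointed_alg_base[OF moment_alg.param])
  from pointed_alg_shift_sum[OF this] obtain g where g: "moment_alg g"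
    "\<And>c X. finite X \<Longrightarrow> (\<Sum>u\<in>X. shift_wt X u * (u * (u - c) * h c X u)) = g c X"
    by blast
  have "descent 0 c (Suc j) X = - 2 / real (Suc j) * g c X" if X: "finite X" for c X
  proof -
    have "(u - 0) * (u - c) * shift_wt X u * descent 0 c j (insert (u - 1) (X - {u}))
       = shift_wt X u * (u * (u - c) * h c X u)" if "u \<in> X" for u
    \<comment> \<open>\<open>h\<close> describes the moved set only if \<open>u - 1\<close> is a new
      point; otherwise the weight makes both sides zero.\<close>
    proof (cases "u - 1 \<in> X")
      case True
      then show ?thesis using X by (simp add: shift_wt_eq_0)
    next
      case False
      then show ?thesis using X that f(2) h(2) by simp
    qed
    then have "(\<Sum>u\<in>X. (u - 0) * (u - c) * shift_wt X u * descent 0 c j (insert (u - 1) (X - {u})))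
       = (\<Sum>u\<in>X. shift_wt X u * (u * (u - c) * h c X u))"
      by (rule sum.cong[OF refl])
    then show ?thesis by (simp only: descent.simps g(2)[OF X])
  qed
  then show ?case
    using moment_alg.mult[OF moment_alg.const[of "- 2 / real (Suc j)"] g(1)] by blast
qed

section \<open>Polynomial dependence on the parameter \<open>c\<close>\<close>

text \<open>The points move polynomially in \<open>c\<close> and stay distinct on \<open>K\<close>,
  so the insertion recursion can be run on the polynomials themselves, and one \<open>q\<close>
  serves all \<open>c\<close> in \<open>K\<close>.\<close>

lemma shift_moment_poly_curve:
  assumes "finite P" "\<And>c. c \<in> K \<Longrightarrow> inj_on (\<lambda>p. poly p c) P"
  shows "\<exists>q. \<forall>c\<in>K. shift_moment r ((\<lambda>p. poly p c) ` P) = poly q c"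
  using assms
proof (induction P arbitrary: r rule: finite_induct)
  case empty
  show ?case by (intro exI[of _ 0]) (simp add: shift_moment_def)
next
  case (insert p P)
  then have "\<forall>r. \<exists>q. \<forall>c\<in>K. shift_moment r ((\<lambda>p. poly p c) ` P) = poly q c"
    by (simp add: inj_on_insert)
  from choice[OF this]
  obtain q where q: "\<And>r c. c \<in> K \<Longrightarrow> shift_moment r ((\<lambda>p. poly p c) ` P) = poly (q r) c"
    by blast
  let ?q = "q r + p ^ r - (\<Sum>i<r. p ^ (r - Suc i) * q i)"
  have "shift_moment r ((\<lambda>p. poly p c) ` insert p P) = poly ?q c" if "c \<in> K" for c
  proof -
    have "poly p c \<notin> (\<lambda>p. poly p c) ` P"
      using insert.prems[OF that] insert.hyps by (simp add: inj_on_insert)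
    then show ?thesis
      using insert.hyps q[OF that] by (simp add: shift_moment_insert poly_sum)
  qed
  then show ?case by blast
qed

lemma moment_alg_poly_curve:
  assumes "moment_alg f" "finite P" "\<And>c. c \<in> K \<Longrightarrow> inj_on (\<lambda>p. poly p c) P"
  shows "\<exists>q. \<forall>c\<in>K. f c ((\<lambda>p. poly p c) ` P) = poly q c"
  using assms(1)
proof (induction rule: moment_alg.induct)
  case (const r)
  show ?case by (intro exI[of _ "[:r:]"]) simp
next
  case param
  show ?case by (intro exI[of _ "[:0, 1:]"]) simp
next
  case (moment r)
  show ?case by (rule shift_moment_poly_curve[OF assms(2,3)])
next
  case (add f g)
  then obtain p q where "\<forall>c\<in>K. f c ((\<lambda>p. poly p c) ` P) = poly p c"
    "\<forall>c\<in>K. g c ((\<lambda>p. poly p c) ` P) = poly q c" by blast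
  then show ?case by (intro exI[of _ "p + q"]) simp
next
  case (mult f g)
  then obtain p q where "\<forall>c\<in>K. f c ((\<lambda>p. poly p c) ` P) = poly p c"
    "\<forall>c\<in>K. g c ((\<lambda>p. poly p c) ` P) = poly q c" by blast
  then show ?case by (intro exI[of _ "p * q"]) simp
qed

definition spread :: "real \<Rightarrow> nat set \<Rightarrow> nat set \<Rightarrow> real set" where
  "spread c A B = real ` A \<union> (\<lambda>b. c + real b) ` B"

lemma descent_spread_poly:
  assumes "finite A" "finite B"
  shows "\<exists>q. \<forall>c. c \<notin> \<int> \<longrightarrow> descent 0 c j (spread c A B) = poly q c"
proof -
  \<comment> \<open>The points of \<open>spread c A B\<close> as polynomials in \<open>c\<close>:
    constants \<open>a\<close> and lines \<open>c + b\<close>, which can meet only at integral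
    \<open>c\<close>.\<close>
  let ?P = "(\<lambda>a. [:real a:]) ` A \<union> (\<lambda>b. [:real b, 1:]) ` B"
  obtain f where f: "moment_alg f" "\<And>c X. finite X \<Longrightarrow> descent 0 c j X = f c X"
    using descent_moment_alg by blast
  have ne: "real a \<noteq> c + real b" if "c \<notin> \<int>" for a b c
    using that by (metis Ints_diff Ints_of_nat add_diff_cancel_right')
  have "inj_on (\<lambda>p. poly p c) ?P" if "c \<notin> \<int>" for c
    using ne[OF that] ne[OF that, symmetric] by (auto simp: inj_on_def add.commute)
  then have "\<exists>q. \<forall>c\<in>-\<int>. f c ((\<lambda>p. poly p c) ` ?P) = poly q c"
    using assms by (intro moment_alg_poly_curve f) auto
  moreover have "(\<lambda>p. poly p c) ` ?P = spread c A B" for c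
    by (auto simp: spread_def image_Un image_image add.commute)
  moreover have "finite (spread c A B)" for c
    using assms by (simp add: spread_def)
  ultimately show ?thesis
    using f(2) by (metis ComplI)
qed

lemma finite_spread: "finite A \<Longrightarrow> finite B \<Longrightarrow> finite (spread c A B)"
  by (simp add: spread_def)

lemma not_Ints_imp_neq:
  assumes "(c::real) \<notin> \<int>"
  shows "real a \<noteq> c + real b"
  using assms by (metis Ints_diff Ints_of_nat add_diff_cancel_right')

text \<open>The roots \<open>0\<close> and \<open>c\<close> of the weight are the bottoms of the two
  components, so steps never leave the natural numbers: where the subtraction in
  \<open>a - 1\<close> or \<open>b - 1\<close> is truncated, the summand is zero.\<close>

lemma descent_spread_Suc:
  assumes "c \<notin> \<int>" "finite A" "finite B"
  shows "descent 0 c (Suc j) (spread c A B) = - 2 / real (Suc j) *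
    ((\<Sum>a\<in>A. real a * (real a - c) * shift_wt (spread c A B) (real a)
        * descent 0 c j (spread c (insert (a - 1) (A - {a})) B)) +
     (\<Sum>b\<in>B. (c + real b) * real b * shift_wt (spread c A B) (c + real b)
        * descent 0 c j (spread c A (insert (b - 1) (B - {b})))))"
proof -
  define t where "t u = (u - 0) * (u - c) * shift_wt (spread c A B) u
     * descent 0 c j (insert (u - 1) (spread c A B - {u}))" for u
  note ne = not_Ints_imp_neq[OF assms(1)] not_Ints_imp_neq[OF assms(1), symmetric]
  have "sum t (spread c A B) = (\<Sum>a\<in>A. t (real a)) + (\<Sum>b\<in>B. t (c + real b))"
    unfolding spread_def using assms ne
    by (subst sum.union_disjoint) (auto simp: sum.reindex inj_on_def)
  moreover have "t (real a) = real a * (real a - c) * shift_wt (spread c A B) (real a)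
        * descent 0 c j (spread c (insert (a - 1) (A - {a})) B)" for a
  proof (cases "a = 0")
    case False
    then have "insert (real a - 1) (spread c A B - {real a})
      = spread c (insert (a - 1) (A - {a})) B"
      using ne by (auto simp: spread_def)
    then show ?thesis by (simp add: t_def)
  qed (simp add: t_def)
  moreover have "t (c + real b) = (c + real b) * real b * shift_wt (spread c A B) (c + real b)
        * descent 0 c j (spread c A (insert (b - 1) (B - {b})))" for b
  proof (cases "b = 0")
    case False
    then have "insert (c + real b - 1) (spread c A B - {c + real b})
      = spread c A (insert (b - 1) (B - {b}))"
      using ne by (auto simp: spread_def algebra_simps)
    then show ?thesis by (simp add: t_def)
  qed (simp add: t_def)
  moreover have "descent 0 c (Suc j) (spread c A B) = - 2 / real (Suc j) * sum t (spread c A B)"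
    by (simp add: t_def)
  ultimately show ?thesis by (simp only:)
qed

lemma sum_nat_set_ge: "finite A \<Longrightarrow> card A choose 2 \<le> \<Sum>A"
proof (induction A rule: finite_linorder_max_induct)
  case (insert b A)
  then have "A \<subseteq> {..<b}" by auto
  then have "card A \<le> b" using card_mono[of "{..<b}" A] by simp
  moreover have "b \<notin> A" using insert by auto
  ultimately show ?case using insert by (simp add: numeral_2_eq_2)
qed simp

lemma lower_element:
  fixes A :: "nat set"
  assumes "finite A" "a \<in> A" "0 < a" "a - 1 \<notin> A"
  shows "finite (insert (a - 1) (A - {a}))" "card (insert (a - 1) (A - {a})) = card A"
    "Suc (\<Sum>(insert (a - 1) (A - {a}))) = \<Sum>A"
proof -
  show "card (insert (a - 1) (A - {a})) = card A"
    using assms card_gt_0_iff[of A] by auto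
  show "Suc (\<Sum>(insert (a - 1) (A - {a}))) = \<Sum>A"
    using assms by (simp add: sum.remove[of A a])
qed (use assms in simp)

text \<open>Each step with nonzero weight keeps both cardinalities and lowers the total sum by one,
  but \<open>n\<close> distinct naturals sum to at least \<open>n choose 2\<close>. For degree sets
  the available excess is the total size of the two partitions.\<close>

lemma descent_spread_eq_0:
  assumes "c \<notin> \<int>" "finite A" "finite B"
    and "\<Sum>A + \<Sum>B < j + (card A choose 2) + (card B choose 2)"
  shows "descent 0 c j (spread c A B) = 0"
  using assms(2-)
proof (induction j arbitrary: A B)
  case 0
  then show ?case using sum_nat_set_ge[of A] sum_nat_set_ge[of B] by simp
next
  case (Suc j)
  have z1: "(\<Sum>a\<in>A. real a * (real a - c) * shift_wt (spread c A B) (real a)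
        * descent 0 c j (spread c (insert (a - 1) (A - {a})) B)) = 0"
  proof (intro sum.neutral ballI)
    fix a assume that: "a \<in> A"
    show "real a * (real a - c) * shift_wt (spread c A B) (real a)
        * descent 0 c j (spread c (insert (a - 1) (A - {a})) B) = 0"
  proof (cases "a = 0 \<or> a - 1 \<in> A")
    case True
    moreover have "real a - 1 \<in> spread c A B" if "a \<noteq> 0" "a - 1 \<in> A"
      using that by (force simp: spread_def)
    ultimately show ?thesis using Suc.prems by (auto simp: shift_wt_eq_0 finite_spread)
  next
    case False
    then have "descent 0 c j (spread c (insert (a - 1) (A - {a})) B) = 0"
      using lower_element[OF Suc.prems(1) that] Suc.prems by (intro Suc.IH) auto
    then show ?thesis by simp
  qed
  qed
  have z2: "(\<Sum>b\<in>B. (c + real b) * real b * shift_wt (spread c A B) (c + real b)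
        * descent 0 c j (spread c A (insert (b - 1) (B - {b})))) = 0"
  proof (intro sum.neutral ballI)
    fix b assume that: "b \<in> B"
    show "(c + real b) * real b * shift_wt (spread c A B) (c + real b)
        * descent 0 c j (spread c A (insert (b - 1) (B - {b}))) = 0"
  proof (cases "b = 0 \<or> b - 1 \<in> B")
    case True
    moreover have "c + real b - 1 \<in> spread c A B" if "b \<noteq> 0" "b - 1 \<in> B"
      using that by (force simp: spread_def)
    ultimately show ?thesis using Suc.prems by (auto simp: shift_wt_eq_0 finite_spread)
  next
    case False
    then have "descent 0 c j (spread c A (insert (b - 1) (B - {b}))) = 0"
      using lower_element[OF Suc.prems(2) that] Suc.prems by (intro Suc.IH) auto
    then show ?thesis by simp
  qed
  qed
  show ?case
    unfolding descent_spread_Suc[OF assms(1) Suc.prems(1,2)] z1 z2 by simp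
qed

section \<open>Growth at half-integral \<open>c\<close> and the degree bound\<close>

lemma half_int_not_Ints: "(c::real) - 1 / 2 \<in> \<int> \<Longrightarrow> c \<notin> \<int>"
proof
  assume "c - 1 / 2 \<in> \<int>" "c \<in> \<int>"
  then have "c - (c - 1 / 2) \<in> \<int>" by (rule Ints_diff[rotated])
  then obtain i where "1 / 2 = real_of_int i" by (auto elim: Ints_cases)
  then have "1 = 2 * i" by linarith
  then show False by presburger
qed

text \<open>Twice every point is an integer, so distinct points are at least \<open>1 / 2\<close>
  apart and each factor \<open>1 - 1 / (u - v)\<close> is at most 3 in absolute value.\<close>

lemma shift_wt_spread_bound:
  assumes "c - 1 / 2 \<in> \<int>" "finite A" "finite B" "u \<in> spread c A B"
  shows "\<bar>shift_wt (spread c A B) u\<bar> \<le> 3 ^ card (spread c A B)"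
proof -
  have int: "2 * x \<in> \<int>" if x: "x \<in> spread c A B" for x
  proof -
    have "2 * c \<in> \<int>"
      using Ints_add[OF Ints_mult[OF Ints_numeral[of "num.Bit0 num.One"] assms(1)] Ints_1]
      by (simp add: algebra_simps)
    then show ?thesis
      using x by (auto simp: spread_def distrib_left)
  qed
  have "\<bar>(u - 1 - v) / (u - v)\<bar> \<le> 3" if "v \<in> spread c A B - {u}" for v
  proof -
    have "2 * u - 2 * v \<in> \<int>" using int assms that by (intro Ints_diff) auto
    then have "\<bar>2 * u - 2 * v\<bar> \<ge> 1" using that by (intro Ints_nonzero_abs_ge1) auto
    then have "\<bar>u - v\<bar> \<ge> 1 / 2" by linarith
    moreover have "\<bar>u - 1 - v\<bar> \<le> \<bar>u - v\<bar> + 1"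
      using abs_triangle_ineq4[of "u - v" 1] by (simp add: algebra_simps)
    moreover have "\<bar>u - v\<bar> + 1 \<le> 3 * \<bar>u - v\<bar>" using calculation(1) by simp
    ultimately have "\<bar>u - 1 - v\<bar> \<le> 3 * \<bar>u - v\<bar>" by (meson order.trans)
    then show ?thesis using that by (simp add: abs_divide divide_le_eq)
  qed
  then have "(\<Prod>v\<in>spread c A B - {u}. \<bar>(u - 1 - v) / (u - v)\<bar>)
      \<le> (\<Prod>v\<in>spread c A B - {u}. 3)"
    by (intro prod_mono) auto
  also have "\<dots> \<le> 3 ^ card (spread c A B)"
    by (simp add: card_mono finite_spread assms power_increasing)
  finally show ?thesis by (simp add: shift_wt_def abs_prod)
qed

lemma descent_spread_bound:
  assumes "finite A" "finite B"
  shows "\<exists>C\<ge>0. \<forall>c. c - 1 / 2 \<in> \<int> \<longrightarrow> \<bar>descent 0 c j (spread c A B)\<bar> \<le> C * (1 + \<bar>c\<bar>) ^ j"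
  using assms
proof (induction j arbitrary: A B)
  case 0
  show ?case by (intro exI[of _ 1]) simp
next
  case (Suc j)
  have "\<forall>a. \<exists>C\<ge>0. \<forall>c. c - 1 / 2 \<in> \<int> \<longrightarrow>
    \<bar>descent 0 c j (spread c (insert (a - 1) (A - {a})) B)\<bar> \<le> C * (1 + \<bar>c\<bar>) ^ j"
    using Suc by simp
  from choice[OF this] obtain C where C: "\<forall>a. 0 \<le> C a \<and> (\<forall>c. c - 1 / 2 \<in> \<int> \<longrightarrow>
    \<bar>descent 0 c j (spread c (insert (a - 1) (A - {a})) B)\<bar> \<le> C a * (1 + \<bar>c\<bar>) ^ j)" ..
  have "\<forall>b. \<exists>C\<ge>0. \<forall>c. c - 1 / 2 \<in> \<int> \<longrightarrow>
    \<bar>descent 0 c j (spread c A (insert (b - 1) (B - {b})))\<bar> \<le> C * (1 + \<bar>c\<bar>) ^ j"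
    using Suc by simp
  from choice[OF this] obtain D where D: "\<forall>b. 0 \<le> D b \<and> (\<forall>c. c - 1 / 2 \<in> \<int> \<longrightarrow>
    \<bar>descent 0 c j (spread c A (insert (b - 1) (B - {b})))\<bar> \<le> D b * (1 + \<bar>c\<bar>) ^ j)" ..
  \<comment> \<open>In \<open>E\<close>, the power \<open>3 ^ n\<close> bounds the weights,
    \<open>a + 1\<close> and \<open>b + 1\<close> come from bounding \<open>a - c\<close> and
    \<open>c + b\<close> by multiples of \<open>1 + \<bar>c\<bar>\<close>, and the leading 2 bounds
    \<open>2 / real (Suc j)\<close>.\<close>
  define n where "n = card A + card B"
  define E where "E = 2 * ((\<Sum>a\<in>A. real a * (real a + 1) * 3 ^ n * C a)
     + (\<Sum>b\<in>B. (real b + 1) * real b * 3 ^ n * D b))"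
  have "\<bar>descent 0 c (Suc j) (spread c A B)\<bar> \<le> E * (1 + \<bar>c\<bar>) ^ Suc j"
    if c: "c - 1 / 2 \<in> \<int>" for c
  proof -
    let ?w = "shift_wt (spread c A B)"
    have "card (spread c A B) \<le> n"
      unfolding spread_def n_def
      by (intro order.trans[OF card_Un_le] add_mono card_image_le Suc.prems)
    then have "(3::real) ^ card (spread c A B) \<le> 3 ^ n" by (simp add: power_increasing)
    then have w: "\<bar>?w u\<bar> \<le> 3 ^ n" if "u \<in> spread c A B" for u
      using shift_wt_spread_bound[OF c Suc.prems that] by linarith
    have 1: "\<bar>real a * (real a - c) * ?w (real a)
        * descent 0 c j (spread c (insert (a - 1) (A - {a})) B)\<bar>
        \<le> real a * (real a + 1) * 3 ^ n * C a * (1 + \<bar>c\<bar>) ^ Suc j" if "a \<in> A" for a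
    proof -
      have "\<bar>real a - c\<bar> \<le> (real a + 1) * (1 + \<bar>c\<bar>)"
        by (simp add: algebra_simps) (smt (verit) mult_nonneg_nonneg of_nat_0_le_iff abs_ge_zero)
      moreover have "\<bar>?w (real a)\<bar> \<le> 3 ^ n" using that by (intro w) (auto simp: spread_def)
      moreover have "\<bar>descent 0 c j (spread c (insert (a - 1) (A - {a})) B)\<bar> \<le> C a * (1 + \<bar>c\<bar>) ^ j"
        using C c by blast
      ultimately have "\<bar>real a * (real a - c) * ?w (real a)
        * descent 0 c j (spread c (insert (a - 1) (A - {a})) B)\<bar>
        \<le> real a * ((real a + 1) * (1 + \<bar>c\<bar>)) * 3 ^ n * (C a * (1 + \<bar>c\<bar>) ^ j)"
        unfolding abs_mult by (intro mult_mono) (auto intro!: mult_nonneg_nonneg)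
      then show ?thesis by (simp add: mult_ac)
    qed
    have 2: "\<bar>(c + real b) * real b * ?w (c + real b)
        * descent 0 c j (spread c A (insert (b - 1) (B - {b})))\<bar>
        \<le> (real b + 1) * real b * 3 ^ n * D b * (1 + \<bar>c\<bar>) ^ Suc j" if "b \<in> B" for b
    proof -
      have "\<bar>c + real b\<bar> \<le> (real b + 1) * (1 + \<bar>c\<bar>)"
        by (simp add: algebra_simps) (smt (verit) mult_nonneg_nonneg of_nat_0_le_iff abs_ge_zero)
      moreover have "\<bar>?w (c + real b)\<bar> \<le> 3 ^ n" using that by (intro w) (auto simp: spread_def)
      moreover have "\<bar>descent 0 c j (spread c A (insert (b - 1) (B - {b})))\<bar> \<le> D b * (1 + \<bar>c\<bar>) ^ j"
        using D c by blast
      ultimately have "\<bar>(c + real b) * real b * ?w (c + real b)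
        * descent 0 c j (spread c A (insert (b - 1) (B - {b})))\<bar>
        \<le> (real b + 1) * (1 + \<bar>c\<bar>) * real b * 3 ^ n * (D b * (1 + \<bar>c\<bar>) ^ j)"
        unfolding abs_mult by (intro mult_mono) (auto intro!: mult_nonneg_nonneg)
      then show ?thesis by (simp add: mult_ac)
    qed
    have "\<bar>descent 0 c (Suc j) (spread c A B)\<bar> = 2 / real (Suc j) *
      \<bar>(\<Sum>a\<in>A. real a * (real a - c) * ?w (real a)
          * descent 0 c j (spread c (insert (a - 1) (A - {a})) B)) +
       (\<Sum>b\<in>B. (c + real b) * real b * ?w (c + real b)
          * descent 0 c j (spread c A (insert (b - 1) (B - {b}))))\<bar>"
      unfolding descent_spread_Suc[OF half_int_not_Ints[OF c] Suc.prems]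
      by (subst abs_mult) simp
    also have "\<dots> \<le> 2 * ((\<Sum>a\<in>A. real a * (real a + 1) * 3 ^ n * C a * (1 + \<bar>c\<bar>) ^ Suc j)
       + (\<Sum>b\<in>B. (real b + 1) * real b * 3 ^ n * D b * (1 + \<bar>c\<bar>) ^ Suc j))"
      using 1 2
      by (intro mult_mono order.trans[OF abs_triangle_ineq] add_mono order.trans[OF sum_abs] sum_mono)
         (auto simp: divide_le_eq)
    also have "\<dots> = E * (1 + \<bar>c\<bar>) ^ Suc j"
      by (simp add: E_def sum_distrib_right distrib_right mult.assoc)
    finally show ?thesis .
  qed
  moreover have "0 \<le> E"
    using C D by (auto simp: E_def intro!: add_nonneg_nonneg sum_nonneg mult_nonneg_nonneg)
  ultimately show ?case by blast
qed

text \<open>Along the half-integers \<open>n + 1 / 2\<close> the quotient of \<open>q\<close> by the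
  power of exponent \<open>degree q\<close> tends to the leading coefficient; if the degree exceeded
  \<open>j\<close>, the bound would force this limit to be 0.\<close>

lemma degree_le_of_half_int_bound:
  fixes q :: "real poly"
  assumes "\<And>c. c - 1 / 2 \<in> \<int> \<Longrightarrow> \<bar>poly q c\<bar> \<le> C * (1 + \<bar>c\<bar>) ^ j"
  shows "degree q \<le> j"
proof (rule ccontr)
  assume "\<not> degree q \<le> j"
  then have deg: "j < degree q" by simp
  define x where "x n = real n + 1 / 2" for n
  have x: "filterlim x at_infinity sequentially"
    unfolding x_def
    by (rule tendsto_add_filterlim_at_infinity'[OF filterlim_real_at_infinity_sequentially tendsto_const])
  have xpos: "x n > 0" "x n - 1 / 2 \<in> \<int>" for n by (auto simp: x_def)
  have "((\<lambda>t. poly ([:1, 1:] ^ j) t / poly (monom 1 (degree q)) t) \<longlongrightarrow> (0::real)) at_infinity"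
    using deg by (intro poly_divide_tendsto_0_at_infinity) (simp add: degree_monom_eq degree_linear_power)
  from filterlim_compose[OF this x]
  have "(\<lambda>n. C * ((1 + x n) ^ j / x n ^ degree q)) \<longlonglongrightarrow> C * 0"
    by (intro tendsto_mult tendsto_const) (simp add: poly_monom poly_power)
  then have lim: "(\<lambda>n. C * ((1 + x n) ^ j / x n ^ degree q)) \<longlonglongrightarrow> 0" by simp
  have "norm (poly q (x n) / x n ^ degree q) \<le> norm (C * ((1 + x n) ^ j / x n ^ degree q)) * 1" for n
  proof -
    have "norm (poly q (x n) / x n ^ degree q) \<le> C * ((1 + x n) ^ j / x n ^ degree q)"
      using assms[OF xpos(2)[of n]] xpos(1)[of n] by (simp add: abs_divide divide_right_mono)
    also have "\<dots> \<le> norm (C * ((1 + x n) ^ j / x n ^ degree q)) * 1"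
      unfolding real_norm_def mult_1_right by (rule abs_ge_self)
    finally show ?thesis .
  qed
  then have "(\<lambda>n. poly q (x n) / x n ^ degree q) \<longlonglongrightarrow> 0"
    by (intro tendsto_0_le[OF lim, of _ 1] always_eventually allI)
  with filterlim_compose[OF poly_divide_tendsto_aux[of q] x] have "lead_coeff q = 0"
    by (rule LIMSEQ_unique)
  then show False using deg by auto
qed

lemma descent_spread_poly_degree:
  assumes "finite A" "finite B"
  shows "\<exists>q. degree q \<le> j \<and> (\<forall>c. c - 1 / 2 \<in> \<int> \<longrightarrow> descent 0 c j (spread c A B) = poly q c)"
proof -
  obtain q where q: "\<forall>c. c \<notin> \<int> \<longrightarrow> descent 0 c j (spread c A B) = poly q c"
    using descent_spread_poly[OF assms] by blast
  moreover obtain C where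
    "\<forall>c. c - 1 / 2 \<in> \<int> \<longrightarrow> \<bar>descent 0 c j (spread c A B)\<bar> \<le> C * (1 + \<bar>c\<bar>) ^ j"
    using descent_spread_bound[OF assms] by blast
  ultimately have "degree q \<le> j"
    by (intro degree_le_of_half_int_bound[of q C]) (metis half_int_not_Ints)
  then show ?thesis using q half_int_not_Ints by blast
qed

subsection \<open>Wronskians of Hermite polynomials\<close>

text \<open>The entries form a function rather than a list, so that a single one can be replaced by
  function update.\<close>

definition wr :: "nat \<Rightarrow> (nat \<Rightarrow> real poly) \<Rightarrow> real poly" where
  "wr N f = (\<Sum>p | p permutes {..<N}. of_int (sign p) * (\<Prod>j<N. (pderiv ^^ p j) (f j)))"

lemma wronskian_map_upt: "wronskian (map f [0..<N]) = wr N f"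
  by (simp add: wronskian_def wr_def)

text \<open>The sum is a determinant with two equal rows.\<close>

lemma sum_signed_prod_eq_0:
  fixes g :: "nat \<Rightarrow> nat \<Rightarrow> 'a::comm_ring_1"
  assumes "i < N" "j < N" "i \<noteq> j" "g i = g j"
  shows "(\<Sum>p | p permutes {..<N}. of_int (sign p) * (\<Prod>j<N. g j (p j))) = 0"
proof -
  let ?M = "mat N N (\<lambda>(i, j). g i j)"
  have "det ?M = 0"
    using assms by (intro det_identical_rows[of _ N i j]) (auto intro!: eq_vecI)
  moreover have "det ?M = (\<Sum>p | p permutes {..<N}. of_int (sign p) * (\<Prod>j<N. g j (p j)))"
    by (subst det_def'[of _ N])
       (auto simp: lessThan_atLeast0 permutes_in_image intro!: sum.cong prod.cong)
  ultimately show ?thesis by simp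
qed

lemma wr_eq_0: "i < N \<Longrightarrow> j < N \<Longrightarrow> i \<noteq> j \<Longrightarrow> f i = f j \<Longrightarrow> wr N f = 0"
  unfolding wr_def using sum_signed_prod_eq_0[of i N j "\<lambda>j i. (pderiv ^^ i) (f j)"] by simp

lemma smult_sum_right: "smult a (sum f A) = (\<Sum>x\<in>A. smult a (f x))"
  by (induction A rule: infinite_finite_induct) (simp_all add: smult_add_right)

lemma wr_linear:
  assumes "k < N"
  shows "wr N (f(k := smult a g + smult b h)) = smult a (wr N (f(k := g))) + smult b (wr N (f(k := h)))"
proof -
  have *: "(\<Prod>j<N. (pderiv ^^ p j) ((f(k := g)) j))
      = (pderiv ^^ p k) g * (\<Prod>j\<in>{..<N} - {k}. (pderiv ^^ p j) (f j))" for g p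
    using assms by (subst prod.remove[of _ k]) auto
  show ?thesis
    unfolding wr_def * by (simp add: higher_pderiv_add higher_pderiv_smult algebra_simps
        sum.distrib smult_add_right smult_sum_right)
qed

definition euler :: "real poly \<Rightarrow> real poly" where
  "euler g = [:0, 1:] * pderiv g"

lemma coeff_euler: "coeff (euler g) m = real m * coeff g m"
  by (cases m) (auto simp: euler_def coeff_pderiv)

lemma euler_sum: "euler (sum f A) = (\<Sum>a\<in>A. euler (f a))"
  using higher_pderiv_sum[of 1 f A] by (simp add: euler_def sum_distrib_left)

text \<open>Differentiation lowers every degree by one, so the commutator of the Euler operator with
  the \<open>i\<close>-th derivative is \<open>- i\<close> times that derivative.\<close>

lemma euler_higher_pderiv:
  "euler ((pderiv ^^ i) g) = (pderiv ^^ i) (euler g) - smult (real i) ((pderiv ^^ i) g)"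
proof (induction i)
  case (Suc i)
  have "(pderiv ^^ Suc i) (euler g)
      = pderiv (euler ((pderiv ^^ i) g) + smult (real i) ((pderiv ^^ i) g))"
    by (simp add: Suc.IH)
  also have "\<dots> = euler ((pderiv ^^ Suc i) g) + smult (real (Suc i)) ((pderiv ^^ Suc i) g)"
    by (simp add: euler_def pderiv_mult pderiv_add pderiv_smult pderiv_pCons smult_add_left)
  finally show ?case by simp
qed simp

lemma sum_permutes_lessThan: "p permutes {..<N} \<Longrightarrow> (\<Sum>k<N. real (p k)) = real (N choose 2)"
proof -
  assume "p permutes {..<N}"
  then have "(\<Sum>k<N. real (p k)) = (\<Sum>k<N. real k)"
    using sum.permute[of p "{..<N}" real] by (simp add: comp_def)
  also have "\<dots> = real (N choose 2)"
    by (induction N) (auto simp: numeral_2_eq_2)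
  finally show ?thesis .
qed

text \<open>The Euler operator is a derivation, so it acts on one factor at a time. Moving it inside
  the derivatives costs the orders \<open>p k\<close>, whose sum is \<open>N choose 2\<close> for
  every permutation.\<close>

lemma euler_wr:
  "euler (wr N f) = (\<Sum>k<N. wr N (f(k := euler (f k)))) - smult (real (N choose 2)) (wr N f)"
proof -
  have *: "euler (of_int (sign p) * (\<Prod>j<N. (pderiv ^^ p j) (f j)))
      = (\<Sum>k<N. of_int (sign p) * (\<Prod>j<N. (pderiv ^^ p j) ((f(k := euler (f k))) j)))
        - smult (real (N choose 2)) (of_int (sign p) * (\<Prod>j<N. (pderiv ^^ p j) (f j)))"
    if p: "p permutes {..<N}" for p
  proof -
    define g where "g j = (pderiv ^^ p j) (f j)" for j
    have "euler (\<Prod>j<N. g j) = (\<Sum>k<N. euler (g k) * (\<Prod>j\<in>{..<N} - {k}. g j))"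
      by (simp add: euler_def pderiv_prod sum_distrib_left mult_ac)
    also have "\<dots> = (\<Sum>k<N. (\<Prod>j<N. (pderiv ^^ p j) ((f(k := euler (f k))) j))
        - smult (real (p k)) (\<Prod>j<N. g j))"
    proof (intro sum.cong refl)
      fix k assume k: "k \<in> {..<N}"
      have "(\<Prod>j<N. (pderiv ^^ p j) ((f(k := euler (f k))) j))
          = (pderiv ^^ p k) (euler (f k)) * (\<Prod>j\<in>{..<N} - {k}. g j)"
        using k by (subst prod.remove[of _ k]) (auto simp: g_def)
      moreover have "(\<Prod>j<N. g j) = g k * (\<Prod>j\<in>{..<N} - {k}. g j)"
        using k by (subst prod.remove[of _ k]) auto
      moreover have "euler (g k) = (pderiv ^^ p k) (euler (f k)) - smult (real (p k)) (g k)"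
        by (simp add: g_def euler_higher_pderiv)
      ultimately show "euler (g k) * (\<Prod>j\<in>{..<N} - {k}. g j)
        = (\<Prod>j<N. (pderiv ^^ p j) ((f(k := euler (f k))) j)) - smult (real (p k)) (\<Prod>j<N. g j)"
        by (simp add: left_diff_distrib)
    qed
    also have "\<dots> = (\<Sum>k<N. \<Prod>j<N. (pderiv ^^ p j) ((f(k := euler (f k))) j))
        - smult (real (N choose 2)) (\<Prod>j<N. g j)"
      by (simp add: sum_subtractf sum_permutes_lessThan[OF p, symmetric] smult_sum)
    finally have "of_int (sign p) * euler (\<Prod>j<N. g j)
       = (\<Sum>k<N. of_int (sign p) * (\<Prod>j<N. (pderiv ^^ p j) ((f(k := euler (f k))) j)))
        - smult (real (N choose 2)) (of_int (sign p) * (\<Prod>j<N. g j))"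
      by (simp only: right_diff_distrib sum_distrib_left mult_smult_right)
    moreover have "euler (of_int s * q) = of_int s * euler q" for s q
      by (simp add: euler_def pderiv_mult mult.left_commute of_int_poly pderiv_smult)
    ultimately show ?thesis by (simp add: g_def)
  qed
  have "euler (wr N f) = (\<Sum>p | p permutes {..<N}.
       (\<Sum>k<N. of_int (sign p) * (\<Prod>j<N. (pderiv ^^ p j) ((f(k := euler (f k))) j)))
        - smult (real (N choose 2)) (of_int (sign p) * (\<Prod>j<N. (pderiv ^^ p j) (f j))))"
    unfolding wr_def euler_sum using * by (intro sum.cong) auto
  also have "\<dots> = (\<Sum>k<N. wr N (f(k := euler (f k)))) - smult (real (N choose 2)) (wr N f)"
    unfolding wr_def sum_subtractf smult_sum_right by (subst sum.swap) simp
  finally show ?thesis .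
qed

section \<open>Hermite polynomials and the coefficient recursion\<close>

lemma pderiv_He: "pderiv (He (Suc n)) = smult (real (Suc n)) (He n)"
proof (induction n rule: less_induct)
  case (less n)
  show ?case
  proof (cases n)
    case (Suc k)
    have "pderiv (He (Suc (Suc k))) = He (Suc k) + [:0, 1:] * pderiv (He (Suc k))
        - smult (real (Suc k)) (pderiv (He k))"
      by (simp add: pderiv_diff pderiv_smult pderiv_mult pderiv_pCons)
    also have "[:0, 1:] * pderiv (He (Suc k)) = smult (real (Suc k)) ([:0, 1:] * He k)"
      using less[of k] Suc by simp
    \<comment> \<open>By the induction hypothesis at a lower index, this derivative is exactly the
      term subtracted in the recurrence for \<open>He (Suc k)\<close>.\<close>
    also have "pderiv (He k) = [:0, 1:] * He k - He (Suc k)"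
    proof (cases k)
      case (Suc l)
      have "pderiv (He k) = smult (real (Suc l)) (He l)"
        using less[of l] \<open>n = Suc k\<close> Suc by simp
      then show ?thesis using Suc by simp
    qed simp
    also have "He (Suc k) + smult (real (Suc k)) ([:0, 1:] * He k)
        - smult (real (Suc k)) ([:0, 1:] * He k - He (Suc k)) = smult (1 + real (Suc k)) (He (Suc k))"
      by (simp only: smult_diff_right smult_add_left) simp
    finally show ?thesis
      using Suc by (simp del: He.simps)
  qed (simp add: pderiv_pCons)
qed

text \<open>The derivative formula followed by the three-term recurrence. For \<open>n < 2\<close>
  the truncated index \<open>n - 2\<close> is harmless because \<open>n * (n - 1)\<close> is
  zero.\<close>

lemma euler_He:
  "euler (He n) = smult (real n) (He n) + smult (real n * (real n - 1)) (He (n - 2))"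
proof (cases n rule: He.cases)
  case (3 k)
  then show ?thesis
    by (simp add: euler_def pderiv_He del: He.simps(3))
       (simp add: smult_diff_right algebra_simps)
qed (simp_all add: euler_def pderiv_pCons)

lemma degree_He_le: "degree (He n) \<le> n"
proof (induction n rule: He.induct)
  case (3 n)
  then show ?case
    by (auto intro!: degree_diff_le order.trans[OF degree_pCons_le] order.trans[OF degree_smult_le])
qed auto

lemma coeff_He_self: "coeff (He n) n = 1"
  by (induction n rule: He.induct) (auto intro!: coeff_eq_0 le_less_trans[OF degree_He_le])

lemma euler_wr_He:
  "euler (wr N (\<lambda>j. He (n j))) = (\<Sum>k<N. smult (real (n k)) (wr N (\<lambda>j. He (n j)))
       + smult (real (n k) * (real (n k) - 1)) (wr N (\<lambda>j. He ((n(k := n k - 2)) j))))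
     - smult (real (N choose 2)) (wr N (\<lambda>j. He (n j)))"
proof -
  have "wr N ((\<lambda>j. He (n j))(k := euler (He (n k)))) = smult (real (n k)) (wr N (\<lambda>j. He (n j)))
       + smult (real (n k) * (real (n k) - 1)) (wr N (\<lambda>j. He ((n(k := n k - 2)) j)))"
    if "k < N" for k
  proof -
    have "(\<lambda>j. He (n j))(k := He (n k)) = (\<lambda>j. He (n j))"
      "(\<lambda>j. He (n j))(k := He (n k - 2)) = (\<lambda>j. He ((n(k := n k - 2)) j))" by auto
    then show ?thesis using that by (simp only: euler_He wr_linear)
  qed
  then show ?thesis by (simp add: euler_wr)
qed

text \<open>The Euler operator multiplies the \<open>m\<close>-th coefficient by \<open>m\<close>.
  The factor on the left vanishes only at the top degree, where the coefficient must be found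
  separately.\<close>

lemma coeff_wr_He_rec:
  "(real m + real (N choose 2) - (\<Sum>k<N. real (n k))) * coeff (wr N (\<lambda>j. He (n j))) m
   = (\<Sum>k<N. real (n k) * (real (n k) - 1) * coeff (wr N (\<lambda>j. He ((n(k := n k - 2)) j))) m)"
proof -
  have "real m * coeff (wr N (\<lambda>j. He (n j))) m = coeff (euler (wr N (\<lambda>j. He (n j)))) m"
    by (simp add: coeff_euler)
  also have "\<dots> = (\<Sum>k<N. real (n k)) * coeff (wr N (\<lambda>j. He (n j))) m
     + (\<Sum>k<N. real (n k) * (real (n k) - 1) * coeff (wr N (\<lambda>j. He ((n(k := n k - 2)) j))) m)
     - real (N choose 2) * coeff (wr N (\<lambda>j. He (n j))) m"
    unfolding euler_wr_He by (simp add: coeff_sum sum.distrib sum_distrib_right)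
  finally show ?thesis by (simp add: algebra_simps)
qed

lemma sum_fun_upd_minus_2:
  fixes n :: "nat \<Rightarrow> nat"
  assumes "k < N" "2 \<le> n k"
  shows "(\<Sum>j<N. (n(k := n k - 2)) j) + 2 = (\<Sum>j<N. n j)"
  using assms by (simp add: sum.remove[of "{..<N}" k])

text \<open>Away from the top degree the recursion hands a nonzero coefficient on to a Wronskian
  with one degree lowered by 2, so induction on the sum of the degrees applies.\<close>

lemma coeff_wr_He_nonzero:
  assumes "coeff (wr N (\<lambda>j. He (n j))) m \<noteq> 0"
  shows "\<exists>j. m + 2 * j + (N choose 2) = (\<Sum>k<N. n k)"
  using assms
proof (induction "\<Sum>k<N. n k" arbitrary: n rule: less_induct)
  case less
  show ?case
  proof (cases "m + (N choose 2) = (\<Sum>k<N. n k)")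
    case False
    then have "real m + real (N choose 2) - (\<Sum>k<N. real (n k)) \<noteq> 0"
      by (metis eq_iff_diff_eq_0 of_nat_add of_nat_eq_iff of_nat_sum)
    then have "(\<Sum>k<N. real (n k) * (real (n k) - 1)
        * coeff (wr N (\<lambda>j. He ((n(k := n k - 2)) j))) m) \<noteq> 0"
      using less.prems unfolding coeff_wr_He_rec[symmetric] by simp
    then obtain k where k: "k < N" "real (n k) * (real (n k) - 1) \<noteq> 0"
      "coeff (wr N (\<lambda>j. He ((n(k := n k - 2)) j))) m \<noteq> 0"
      by (metis (no_types, lifting) lessThan_iff mult_eq_0_iff sum.neutral)
    have 2: "2 \<le> n k" using k(2) by (cases "n k" rule: He.cases) auto
    note s = sum_fun_upd_minus_2[of k N n, OF k(1) 2]
    from less.hyps[OF _ k(3)] s obtain j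
      where "m + 2 * j + (N choose 2) = (\<Sum>j<N. (n(k := n k - 2)) j)" by auto
    with s have "m + 2 * Suc j + (N choose 2) = (\<Sum>k<N. n k)" by simp
    then show ?thesis by blast
  qed (auto intro!: exI[of _ 0])
qed

section \<open>The top coefficient as a Vandermonde product\<close>

text \<open>The falling factorial of length \<open>r\<close>; its value at \<open>n\<close> is the
  factor that \<open>r\<close> differentiations put on the monomial of degree
  \<open>n\<close>.\<close>

definition ffact_poly :: "nat \<Rightarrow> real poly" where
  "ffact_poly r = (\<Prod>i<r. [:- real i, 1:])"

lemma degree_ffact_poly: "degree (ffact_poly r) = r"
  by (simp add: ffact_poly_def degree_prod_eq_sum_degree)

lemma coeff_ffact_poly_self: "coeff (ffact_poly r) r = 1"
  using lead_coeff_prod[of "\<lambda>i. [:- real i, 1:]" "{..<r}"] degree_ffact_poly[of r]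
  by (simp add: ffact_poly_def)

definition vandermonde :: "nat \<Rightarrow> (nat \<Rightarrow> real) \<Rightarrow> real" where
  "vandermonde N x = (\<Prod>j<N. \<Prod>i<j. x j - x i)"

lemma vandermonde_eq_0: "i < N \<Longrightarrow> j < N \<Longrightarrow> i \<noteq> j \<Longrightarrow> x i = x j \<Longrightarrow> vandermonde N x = 0"
proof (induction i j rule: linorder_wlog)
  case (le i j)
  then have ij: "i < j" "j < N" "x i = x j" by simp_all
  have z: "(\<Prod>i<j. x j - x i) = 0" by (rule prod_zero) (use ij in \<open>auto intro!: bexI[of _ i]\<close>)
  show ?case unfolding vandermonde_def
    by (rule prod_zero[OF _ bexI[of _ j]]) (use ij z in simp_all)
qed simp

lemma vandermonde_nonzero:
  assumes "inj_on x {..<N}"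
  shows "vandermonde N x \<noteq> 0"
proof -
  have "x j \<noteq> x i" if "j < N" "i < j" for i j
    using assms that by (metis inj_on_def lessThan_iff less_trans less_irrefl)
  then show ?thesis by (auto simp: vandermonde_def)
qed

text \<open>Expanding along the last row, the determinant is a polynomial in the last variable whose
  roots are the other variables.\<close>

lemma sum_signed_prod_ffact:
  "(\<Sum>p | p permutes {..<N}. of_int (sign p) * (\<Prod>j<N. poly (ffact_poly (p j)) (x j)))
    = vandermonde N x"
proof (cases "inj_on x {..<N}")
  case False
  then obtain i j where "i < N" "j < N" "i \<noteq> j" "x i = x j" by (auto simp: inj_on_def)
  then show ?thesis
    using sum_signed_prod_eq_0[of i N j "\<lambda>j i. poly (ffact_poly i) (x j)"]
      vandermonde_eq_0[of i N j x] by simp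
next
  case True
  define M where "M N x = mat N N (\<lambda>(i, j). poly (ffact_poly j) (x i))" for N and x :: "nat \<Rightarrow> real"
  have M: "M N x \<in> carrier_mat N N" for N x by (simp add: M_def)
  have det_M: "det (M N x)
    = (\<Sum>p | p permutes {..<N}. of_int (sign p) * (\<Prod>j<N. poly (ffact_poly (p j)) (x j)))" for N x
    by (subst det_def'[OF M])
       (auto simp: M_def lessThan_atLeast0 permutes_in_image intro!: sum.cong prod.cong)
  have "det (M N x) = vandermonde N x" using True
  proof (induction N)
    case 0
    then show ?case by (simp add: vandermonde_def M_def)
  next
    case (Suc N)
    define Q where "Q = (\<Sum>j<Suc N. smult (cofactor (M (Suc N) x) N j) (ffact_poly j))"
    have del: "mat_delete (M (Suc N) (x(N := t))) N j = mat_delete (M (Suc N) x) N j" for t j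
      by (auto simp: mat_delete_def M_def intro!: eq_matI)
    have Q: "poly Q t = det (M (Suc N) (x(N := t)))" for t
      unfolding laplace_expansion_row[OF M lessI]
      by (simp add: Q_def poly_sum cofactor_def del) (simp add: M_def mult.commute)
    have "mat_delete (M (Suc N) x) N N = M N x"
      by (auto simp: mat_delete_def M_def intro!: eq_matI)
    then have cof: "cofactor (M (Suc N) x) N N = vandermonde N x"
      using Suc by (simp add: cofactor_def inj_on_def)
    have "coeff (ffact_poly j) N = 0" if "j < N" for j
      using that by (simp add: coeff_eq_0 degree_ffact_poly)
    then have coeff: "coeff Q N = vandermonde N x"
      by (simp add: Q_def coeff_sum cof coeff_ffact_poly_self)
    have deg: "degree Q \<le> N"
      unfolding Q_def by (intro degree_sum_le order.trans[OF degree_smult_le]) (auto simp: degree_ffact_poly)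
    have "Q = smult (vandermonde N x) (\<Prod>i<N. [:- x i, 1:])"
    proof (rule poly_eqI_degree_lead_coeff[where A = "x ` {..<N}" and n = N])
      show "degree Q \<le> N" by fact
      have d: "degree (\<Prod>i<N. [:- x i, 1:]) = N"
        by (simp add: degree_prod_eq_sum_degree)
      then show "degree (smult (vandermonde N x) (\<Prod>i<N. [:- x i, 1:])) \<le> N"
        by (metis degree_smult_le)
      show "N \<le> card (x ` {..<N})"
        using Suc.prems by (simp add: card_image inj_on_def)
      show "coeff Q N = coeff (smult (vandermonde N x) (\<Prod>i<N. [:- x i, 1:])) N"
        using lead_coeff_prod[of "\<lambda>i. [:- x i, 1:]" "{..<N}"] d coeff by simp
      show "poly Q z = poly (smult (vandermonde N x) (\<Prod>i<N. [:- x i, 1:])) z"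
        if z: "z \<in> x ` {..<N}" for z
      proof -
        from z obtain i where i: "i < N" "z = x i" by auto
        then have "det (M (Suc N) (x(N := z))) = 0"
          by (intro det_identical_rows[of _ "Suc N" i N]) (auto simp: M_def intro!: eq_vecI)
        moreover have "(\<Prod>i<N. z - x i) = 0" using i by auto
        ultimately show ?thesis by (simp add: Q poly_prod)
      qed
    qed
    then have "det (M (Suc N) x) = vandermonde N x * (\<Prod>i<N. x N - x i)"
      using Q[of "x N"] by (simp add: poly_prod)
    then show ?case by (simp add: vandermonde_def)
  qed
  then show ?thesis using det_M by simp
qed

lemma coeff_mult_add_bounds:
  fixes p q :: "'a::comm_semiring_0 poly"
  assumes "degree p \<le> a" "degree q \<le> b"
  shows "coeff (p * q) (a + b) = coeff p a * coeff q b"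
proof (cases "degree p = a \<and> degree q = b")
  case True
  then show ?thesis by (metis coeff_mult_degree_sum)
next
  case False
  then have "degree p + degree q < a + b" "coeff p a = 0 \<or> coeff q b = 0"
    using assms by (auto intro: coeff_eq_0)
  then show ?thesis
    using coeff_eq_0[of "p * q" "a + b"] degree_mult_le[of p q] by auto
qed

lemma coeff_prod_sum_bounds:
  fixes f :: "'b \<Rightarrow> 'a::comm_semiring_1 poly"
  assumes "finite A" "\<And>i. i \<in> A \<Longrightarrow> degree (f i) \<le> d i"
  shows "degree (prod f A) \<le> sum d A \<and> coeff (prod f A) (sum d A) = (\<Prod>i\<in>A. coeff (f i) (d i))"
  using assms
proof (induction A rule: finite_induct)
  case (insert i A)
  then show ?case
    by (auto simp: coeff_mult_add_bounds intro!: order.trans[OF degree_mult_le] add_mono)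
qed auto

lemma coeff_higher_pderiv_He:
  assumes "r \<le> n"
  shows "coeff ((pderiv ^^ r) (He n)) (n - r) = poly (ffact_poly r) (real n)"
proof -
  have "pochhammer (real (Suc (n - r))) r = (\<Prod>i<r. real n - real (r - Suc i))"
    unfolding pochhammer_prod lessThan_atLeast0 using assms by (intro prod.cong) auto
  also have "\<dots> = (\<Prod>i<r. real n - real i)"
    by (rule prod.nat_diff_reindex)
  finally show ?thesis
    using assms by (simp add: coeff_higher_pderiv coeff_He_self ffact_poly_def poly_prod)
qed

text \<open>The derivative orders of each permutation sum to \<open>N choose 2\<close>, so
  \<open>m\<close> is the sum of the degree bounds \<open>n j - p j\<close> and only leading
  coefficients contribute. Their alternating sum is the Vandermonde determinant in the falling
  factorial basis.\<close>

lemma coeff_wr_He_top: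
  assumes "m + (N choose 2) = (\<Sum>k<N. n k)"
  shows "coeff (wr N (\<lambda>j. He (n j))) m = vandermonde N (\<lambda>j. real (n j))"
proof -
  have "coeff (\<Prod>j<N. (pderiv ^^ p j) (He (n j))) m = (\<Prod>j<N. poly (ffact_poly (p j)) (real (n j)))"
    if p: "p permutes {..<N}" for p
  proof (cases "\<forall>j<N. p j \<le> n j")
    case True
    have "(\<Sum>j<N. n j - p j) + (\<Sum>j<N. p j) = (\<Sum>j<N. n j)"
      using True by (simp flip: sum.distrib)
    moreover have "(\<Sum>j<N. p j) = N choose 2"
      using sum_permutes_lessThan[OF p] by (metis of_nat_eq_iff of_nat_sum)
    ultimately have "m = (\<Sum>j<N. n j - p j)" using assms by simp
    moreover have "degree ((pderiv ^^ p j) (He (n j))) \<le> n j - p j" for j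
      using degree_He_le[of "n j"] by (simp add: degree_higher_pderiv diff_le_mono)
    ultimately have "coeff (\<Prod>j<N. (pderiv ^^ p j) (He (n j))) m
        = (\<Prod>j<N. coeff ((pderiv ^^ p j) (He (n j))) (n j - p j))"
      using coeff_prod_sum_bounds[of "{..<N}" "\<lambda>j. (pderiv ^^ p j) (He (n j))" "\<lambda>j. n j - p j"]
      by simp
    then show ?thesis using True by (simp add: coeff_higher_pderiv_He)
  next
    \<comment> \<open>Differentiating more than \<open>n j\<close> times kills the factor, and the
      falling factorial of length \<open>p j\<close> has the root \<open>n j\<close>.\<close>
    case False
    then obtain j where j: "j < N" "n j < p j" by auto
    have "degree (He (n j)) < p j" using j degree_He_le[of "n j"] by simp
    then have "(pderiv ^^ p j) (He (n j)) = 0"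
      by (intro poly_eqI) (simp add: coeff_higher_pderiv coeff_eq_0)
    then have "(\<Prod>j<N. (pderiv ^^ p j) (He (n j))) = 0"
      using j by (intro prod_zero) auto
    moreover have "poly (ffact_poly (p j)) (real (n j)) = 0"
      using j by (auto simp: ffact_poly_def poly_prod)
    then have "(\<Prod>j<N. poly (ffact_poly (p j)) (real (n j))) = 0"
      using j by (intro prod_zero) auto
    ultimately show ?thesis by (simp only: coeff_0)
  qed
  then show ?thesis
    unfolding wr_def
    by (simp add: coeff_sum of_int_poly flip: sum_signed_prod_ffact)
qed

section \<open>All coefficients as weighted descents\<close>

lemma prod_pairs_eq:
  fixes r :: "nat \<Rightarrow> nat \<Rightarrow> 'a::comm_monoid_mult"
  assumes "k < N" "\<And>i j. r i j = r j i" "\<And>i j. i \<noteq> k \<Longrightarrow> j \<noteq> k \<Longrightarrow> r i j = 1"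
  shows "(\<Prod>j<N. \<Prod>i<j. r i j) = (\<Prod>i\<in>{..<N} - {k}. r i k)"
  using assms(1)
proof (induction N)
  case (Suc N)
  show ?case
  proof (cases "k = N")
    case True
    have "(\<Prod>j<N. \<Prod>i<j. r i j) = 1"
      using True assms(3) by (intro prod.neutral ballI) auto
    moreover have "{..<Suc N} - {k} = {..<N}" using True by auto
    ultimately show ?thesis using True by simp
  next
    case False
    then have k: "k < N" using Suc.prems by simp
    have "(\<Prod>i<N. r i N) = r k N * (\<Prod>i\<in>{..<N} - {k}. r i N)"
      using k by (subst prod.remove[of _ k]) auto
    also have "(\<Prod>i\<in>{..<N} - {k}. r i N) = 1"
      using k assms(3) by (intro prod.neutral ballI) auto
    finally have "(\<Prod>i<N. r i N) = r N k" using assms(2) by simp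
    moreover have "{..<Suc N} - {k} = insert N ({..<N} - {k})" using False by auto
    ultimately show ?thesis using Suc.IH[OF k] by (simp add: mult.commute)
  qed
qed simp

lemma vandermonde_fun_upd:
  assumes "inj_on x {..<N}" "k < N"
  shows "vandermonde N (x(k := y)) = vandermonde N x * (\<Prod>i\<in>{..<N} - {k}. (y - x i) / (x k - x i))"
proof -
  \<comment> \<open>The ratio of the new to the old Vandermonde factor of a pair; it is symmetric
    because both differences change sign together.\<close>
  define r where "r i j = (if i = j \<or> i \<noteq> k \<and> j \<noteq> k then 1 else ((x(k := y)) j - (x(k := y)) i) / (x j - x i))" for i j
  have flip: "(a - b) / (c - d) = (b - a) / (d - c)" for a b c d :: real
    by (metis minus_diff_eq minus_divide_divide)
  have "(\<Prod>j<N. \<Prod>i<j. r i j) = (\<Prod>i\<in>{..<N} - {k}. r i k)"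
    using assms(2) by (rule prod_pairs_eq) (auto simp: r_def intro: flip)
  moreover have "vandermonde N (x(k := y)) = vandermonde N x * (\<Prod>j<N. \<Prod>i<j. r i j)"
    unfolding vandermonde_def prod.distrib[symmetric]
  proof (intro prod.cong refl)
    fix j i assume "j \<in> {..<N}" "i \<in> {..<j}"
    then have "x j \<noteq> x i" "i \<noteq> j"
      using assms(1) by (auto dest!: inj_onD)
    then show "(x(k := y)) j - (x(k := y)) i = (x j - x i) * r i j"
      by (simp add: r_def)
  qed
  moreover have "(\<Prod>i\<in>{..<N} - {k}. r i k) = (\<Prod>i\<in>{..<N} - {k}. (y - x i) / (x k - x i))"
    by (intro prod.cong) (auto simp: r_def)
  ultimately show ?thesis by simp
qed

lemma coeff_wr_He:
  assumes "m + 2 * j + (N choose 2) = (\<Sum>k<N. n k)"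
  shows "coeff (wr N (\<lambda>k. He (n k))) m
    = vandermonde N (\<lambda>k. real (n k)) * descent 0 (1 / 2) j ((\<lambda>k. real (n k) / 2) ` {..<N})"
  using assms
proof (induction j arbitrary: n)
  case 0
  then show ?case by (simp add: coeff_wr_He_top)
next
  case (Suc j)
  show ?case
  proof (cases "inj_on n {..<N}")
    case False
    then obtain i k where "i < N" "k < N" "i \<noteq> k" "n i = n k" by (auto simp: inj_on_def)
    then show ?thesis
      using wr_eq_0[of i N k "\<lambda>k. He (n k)"] vandermonde_eq_0[of i N k "\<lambda>k. real (n k)"] by simp
  next
    case inj: True
    define V where "V = vandermonde N (\<lambda>k. real (n k))"
    define X where "X = (\<lambda>k. real (n k) / 2) ` {..<N}"
    define t where "t u = (u - 0) * (u - 1 / 2) * shift_wt X u * descent 0 (1 / 2) j (insert (u - 1) (X - {u}))"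
      for u
    have summand: "real (n k) * (real (n k) - 1) * coeff (wr N (\<lambda>j. He ((n(k := n k - 2)) j))) m
        = 4 * V * t (real (n k) / 2)" if k: "k < N" for k
    \<comment> \<open>The degrees 0 and 1 correspond to the roots \<open>0\<close> and
      \<open>1 / 2\<close> of the weight.\<close>
    proof (cases "2 \<le> n k")
      case False
      then have "n k = 0 \<or> n k = 1" by auto
      then show ?thesis by (auto simp: t_def)
    next
      case True
      have "m + 2 * j + (N choose 2) = (\<Sum>i<N. (n(k := n k - 2)) i)"
        using sum_fun_upd_minus_2[of k N n, OF k True] Suc.prems by simp
      note IH = Suc.IH[OF this]
      have upd: "(\<lambda>i. real ((n(k := n k - 2)) i)) = (\<lambda>i. real (n i))(k := real (n k) - 2)"
        using True by (auto simp: of_nat_diff)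
      have "inj_on (\<lambda>i. real (n i)) {..<N}" using inj by (auto simp: inj_on_def)
      note V' = vandermonde_fun_upd[OF this k, of "real (n k) - 2", folded V_def]
      have Xk: "X - {real (n k) / 2} = (\<lambda>i. real (n i) / 2) ` ({..<N} - {k})"
        using inj k by (auto simp: X_def inj_on_def)
      have half: "(a / 2) / (b / 2) = a / b" for a b :: real by simp
      have "shift_wt X (real (n k) / 2)
          = (\<Prod>i\<in>{..<N} - {k}. (real (n k) / 2 - 1 - real (n i) / 2) / (real (n k) / 2 - real (n i) / 2))"
        unfolding shift_wt_def Xk
        using inj by (subst prod.reindex) (auto simp: inj_on_def)
      moreover have "(\<Prod>i\<in>{..<N} - {k}. (real (n k) / 2 - 1 - real (n i) / 2) / (real (n k) / 2 - real (n i) / 2))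
          = (\<Prod>i\<in>{..<N} - {k}. (real (n k) - 2 - real (n i)) / (real (n k) - real (n i)))"
      proof (rule prod.cong[OF refl])
        fix i
        have "real (n k) / 2 - 1 - real (n i) / 2 = (real (n k) - 2 - real (n i)) / 2"
          "real (n k) / 2 - real (n i) / 2 = (real (n k) - real (n i)) / 2"
          by (simp_all add: diff_divide_distrib)
        then show "(real (n k) / 2 - 1 - real (n i) / 2) / (real (n k) / 2 - real (n i) / 2)
          = (real (n k) - 2 - real (n i)) / (real (n k) - real (n i))"
          by (simp only: half)
      qed
      ultimately have wt: "shift_wt X (real (n k) / 2)
          = (\<Prod>i\<in>{..<N} - {k}. (real (n k) - 2 - real (n i)) / (real (n k) - real (n i)))"
        by (simp only:)
      have "(\<lambda>i. real ((n(k := n k - 2)) i) / 2) ` {..<N}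
          = insert (real (n k) / 2 - 1) (X - {real (n k) / 2})"
      proof -
        have "f ` {..<N} = insert (f k) (f ` ({..<N} - {k}))" for f :: "nat \<Rightarrow> real"
          using k by auto
        then have "(\<lambda>i. real ((n(k := n k - 2)) i) / 2) ` {..<N}
          = insert (real (n k - 2) / 2) ((\<lambda>i. real ((n(k := n k - 2)) i) / 2) ` ({..<N} - {k}))"
          by (simp only: fun_upd_same)
        also have "(\<lambda>i. real ((n(k := n k - 2)) i) / 2) ` ({..<N} - {k}) = X - {real (n k) / 2}"
          unfolding Xk by (intro image_cong) auto
        finally show ?thesis using True by (simp add: of_nat_diff diff_divide_distrib)
      qed
      then have "coeff (wr N (\<lambda>j. He ((n(k := n k - 2)) j))) m
          = V * shift_wt X (real (n k) / 2)
            * descent 0 (1 / 2) j (insert (real (n k) / 2 - 1) (X - {real (n k) / 2}))"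
        using IH unfolding upd V' wt by simp
      then show ?thesis by (simp add: t_def field_simps)
    qed
    \<comment> \<open>Dividing the factor 4 of the summands by this number yields the prefactor
      \<open>- 2 / real (Suc j)\<close> of \<open>descent\<close>.\<close>
    have "real m + real (N choose 2) - (\<Sum>k<N. real (n k)) = - 2 * real (Suc j)"
      using Suc.prems by (simp flip: of_nat_sum)
    then have "- 2 * real (Suc j) * coeff (wr N (\<lambda>k. He (n k))) m = (\<Sum>k<N. 4 * V * t (real (n k) / 2))"
      using coeff_wr_He_rec[of m N n] summand by simp
    also have "\<dots> = 4 * V * sum t X"
      unfolding X_def using inj by (subst sum.reindex) (auto simp: inj_on_def sum_distrib_left)
    finally have eq: "- 2 * real (Suc j) * coeff (wr N (\<lambda>k. He (n k))) m = 4 * V * sum t X" .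
    have "c = V * (- 2 / s * S)" if "- 2 * s * c = 4 * V * S" "s \<noteq> 0" for c s S :: real
      using that by (simp add: field_simps)
    from this[OF eq] have "coeff (wr N (\<lambda>k. He (n k))) m = V * (- 2 / real (Suc j) * sum t X)"
      by simp
    then show ?thesis by (simp add: V_def X_def t_def)
  qed
qed

subsection \<open>Degree sets and Maya diagrams\<close>

definition degset :: "nat list \<Rightarrow> nat set" where
  "degset lam = degvec lam ` {..<length lam}"

lemma inj_on_degvec:
  assumes "is_partition lam"
  shows "inj_on (degvec lam) {..<length lam}"
proof (rule linorder_inj_onI')
  fix i j assume ij: "i \<in> {..<length lam}" "j \<in> {..<length lam}" "i < j"
  have "lam ! j \<le> lam ! i"
    using assms ij by (intro sorted_rev_nth_mono) (auto simp: is_partition_def)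
  then show "degvec lam i \<noteq> degvec lam j" using ij by (simp add: degvec_def)
qed

lemma finite_degset: "finite (degset lam)"
  by (simp add: degset_def)

lemma card_degset: "is_partition lam \<Longrightarrow> card (degset lam) = length lam"
  by (simp add: degset_def card_image inj_on_degvec)

lemma sum_degvec: "(\<Sum>i<length lam. degvec lam i) = psize lam + (length lam choose 2)"
proof -
  have "(\<Sum>i<length lam. degvec lam i) = (\<Sum>i<length lam. lam ! i) + (\<Sum>i<length lam. length lam - Suc i)"
    by (simp add: degvec_def flip: sum.distrib)
  also have "(\<Sum>i<n. n - Suc i) = n choose 2" for n :: nat
    unfolding sum.nat_diff_reindex[of "\<lambda>i. i"] by (induction n) (auto simp: numeral_2_eq_2)
  finally show ?thesis by (simp add: psize_def sum_list_sum_nth lessThan_atLeast0)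
qed

lemma sum_degset: "is_partition lam \<Longrightarrow> \<Sum>(degset lam) = psize lam + (length lam choose 2)"
  by (simp add: degset_def sum.reindex inj_on_degvec sum_degvec)

lemma He_part_eq:
  "He_part lam = smult (1 / vandermonde (length lam) (\<lambda>i. real (degvec lam i)))
     (wr (length lam) (\<lambda>i. He (degvec lam i)))"
  by (simp add: He_part_def wronskian_map_upt Delta_def vandermonde_def)

lemma coeff_He_part:
  assumes "is_partition lam" "m + 2 * j = psize lam"
  shows "coeff (He_part lam) m = descent 0 (1 / 2) j ((\<lambda>n. real n / 2) ` degset lam)"
proof -
  have "inj_on (\<lambda>i. real (degvec lam i)) {..<length lam}"
    using inj_on_degvec[OF assms(1)] by (simp add: inj_on_def)
  then have "vandermonde (length lam) (\<lambda>i. real (degvec lam i)) \<noteq> 0"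
    by (rule vandermonde_nonzero)
  then show ?thesis
    using coeff_wr_He[of m j "length lam" "degvec lam"] assms
    by (simp add: He_part_eq sum_degvec degset_def image_image)
qed

lemma coeff_He_part_nonzero:
  "coeff (He_part lam) m \<noteq> 0 \<Longrightarrow> \<exists>j. m + 2 * j = psize lam"
  using coeff_wr_He_nonzero[of "length lam" "degvec lam" m] by (auto simp: He_part_eq sum_degvec)

(* Degree sets describe a partition only up to padding: a Maya diagram shifted by g. *)
definition pad :: "nat \<Rightarrow> nat set \<Rightarrow> nat set" where
  "pad g D = {..<g} \<union> (\<lambda>d. g + d) ` D"

lemma finite_pad: "finite D \<Longrightarrow> finite (pad g D)"
  by (simp add: pad_def)

lemma card_pad: "finite D \<Longrightarrow> card (pad g D) = g + card D"
  unfolding pad_def by (subst card_Un_disjoint) (auto simp: card_image)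

lemma choose_two_add: "(m + n choose 2) = (m choose 2) + (n choose 2) + m * n"
  by (induction m) (auto simp: numeral_2_eq_2)

lemma sum_lessThan_nat: "\<Sum>{..<g::nat} = g choose 2"
  by (induction g) (auto simp: numeral_2_eq_2 lessThan_Suc)

lemma sum_pad:
  assumes "finite D"
  shows "\<Sum>(pad g D) + (card D choose 2) = \<Sum>D + (card (pad g D) choose 2)"
proof -
  have "\<Sum>(pad g D) = \<Sum>{..<g} + \<Sum>((\<lambda>d. g + d) ` D)"
    unfolding pad_def using assms by (intro sum.union_disjoint) auto
  also have "\<Sum>((\<lambda>d. g + d) ` D) = card D * g + \<Sum>D"
    by (simp add: sum.reindex sum.distrib)
  finally show ?thesis
    using assms by (simp add: card_pad choose_two_add sum_lessThan_nat)
qed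

text \<open>Padding by one translates the halved set by \<open>1 / 2\<close> and inserts the root 0.
  Deleting that root turns the roots \<open>0, 1 / 2\<close> into \<open>1, 1 / 2\<close>, and
  translating back by \<open>1 / 2\<close> restores the original pair in the other order.\<close>

lemma descent_pad:
  assumes "finite D"
  shows "descent 0 (1 / 2) j ((\<lambda>n. real n / 2) ` pad g D) = descent 0 (1 / 2) j ((\<lambda>n. real n / 2) ` D)"
proof (induction g)
  case 0
  then show ?case by (simp add: pad_def)
next
  case (Suc g)
  let ?X = "(\<lambda>n. real n / 2) ` pad g D"
  have "pad (Suc g) D = insert 0 (Suc ` pad g D)"
    by (auto simp: pad_def image_iff less_Suc_eq_0_disj)
  then have "(\<lambda>n. real n / 2) ` pad (Suc g) D = insert 0 ((\<lambda>x. x + 1 / 2) ` ?X)"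
    by (simp add: image_image add_divide_distrib add.commute)
  moreover have "0 \<notin> (\<lambda>x. x + 1 / 2) ` ?X" by auto
  ultimately have "descent 0 (1 / 2) j ((\<lambda>n. real n / 2) ` pad (Suc g) D)
      = descent (0 + 1) (1 / 2) j ((\<lambda>x. x + 1 / 2) ` ?X)"
    using descent_insert_root[of "(\<lambda>x. x + 1 / 2) ` ?X" 0] finite_pad[OF assms] by simp
  also have "\<dots> = descent 0 (1 / 2) j ?X"
    using descent_translate[of 0 "1 / 2" "1 / 2" j ?X] by (simp add: descent_commute)
  finally show ?case using Suc by simp
qed

text \<open>After halving, the even elements start with \<open>s\<close> consecutive points from the
  root 0 and the odd ones with \<open>s'\<close> consecutive points from the root
  \<open>1 / 2\<close>. Stripping both segments moves the roots to \<open>s\<close> and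
  \<open>1 / 2 + s'\<close>; translation by \<open>- s\<close> puts them at 0 and
  \<open>c\<close>.\<close>

lemma descent_interleave:
  assumes "finite A" "finite B"
  shows "descent 0 (1 / 2) j
      ((\<lambda>n. real n / 2) ` ((\<lambda>n. 2 * n) ` pad s A \<union> (\<lambda>n. 2 * n + 1) ` pad s' B))
    = descent 0 (1 / 2 + real s' - real s) j (spread (1 / 2 + real s' - real s) A B)"
proof -
  define c where "c = 1 / 2 + real s' - real s"
  define Z where "Z = (\<lambda>a. real s + real a) ` A \<union> (\<lambda>b. 1 / 2 + real s' + real b) ` B"
  define Y where "Y = (\<lambda>i. 1 / 2 + real i) ` {..<s'} \<union> Z"
  have ne: "1 / 2 + real a \<noteq> real b" "real b \<noteq> 1 / 2 + real a" for a b
    using not_Ints_imp_neq[OF half_int_not_Ints[of "1 / 2"], of b a] by simp_all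
  have fin: "finite Y" "finite Z" using assms by (auto simp: Y_def Z_def)
  have "(\<lambda>n. real n / 2) ` ((\<lambda>n. 2 * n) ` pad s A \<union> (\<lambda>n. 2 * n + 1) ` pad s' B)
      = (\<lambda>i. 0 + real i) ` {..<s} \<union> Y"
    by (simp add: pad_def Y_def Z_def image_Un image_image add_divide_distrib add_ac Un_ac)
  also have "descent 0 (1 / 2) j \<dots> = descent (0 + real s) (1 / 2) j Y"
  proof (rule descent_strip[OF fin(1)])
    show "Y \<inter> (\<lambda>i. 0 + real i) ` {..<s} = {}"
      using ne[of _ ] ne(1)[of "s' + _"] by (auto simp: Y_def Z_def add.assoc simp flip: of_nat_add)
  qed
  also have "\<dots> = descent (1 / 2) (real s) j Y" by (simp add: descent_commute)
  also have "\<dots> = descent (1 / 2 + real s') (real s) j Z"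
    unfolding Y_def
  proof (rule descent_strip[OF fin(2)])
    show "Z \<inter> (\<lambda>i. 1 / 2 + real i) ` {..<s'} = {}"
      using ne by (auto simp: Z_def simp flip: of_nat_add)
  qed
  also have "\<dots> = descent (0 + real s) (c + real s) j ((\<lambda>x. x + real s) ` spread c A B)"
  proof -
    have "(\<lambda>x. x + real s) ` spread c A B = Z"
      by (simp add: spread_def Z_def c_def image_Un image_image add_ac)
    then show ?thesis by (simp add: c_def descent_commute)
  qed
  also have "\<dots> = descent 0 c j (spread c A B)" by (rule descent_translate)
  finally show ?thesis by (simp add: c_def)
qed

section \<open>Maya diagrams and the partition \<open>Phi\<close>\<close>

text \<open>With \<open>g\<close> the first gap, the elements below \<open>g\<close> have no gap
  beneath them and form the padding, while the elements above \<open>g\<close> carry the positive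
  parts.\<close>

lemma part_of_maya:
  assumes "finite S"
  defines "lam \<equiv> part_of_maya ({n. n < 0} \<union> int ` S)"
  shows "is_partition lam" "\<exists>g. S = pad g (degset lam)"
proof -
  define M where "M = {n. n < 0} \<union> int ` S"
  define g where "g = (LEAST n. n \<notin> S)"
  define T where "T = {m \<in> S. g < m}"
  define xs where "xs = sorted_list_of_set T"
  define h where "h m = card {n. n \<notin> S \<and> n < m}" for m
  have "\<exists>n. n \<notin> S" using assms(1) ex_new_if_finite infinite_UNIV_nat by blast
  then have g: "g \<notin> S" unfolding g_def by (rule LeastI_ex)
  have less_g: "n \<in> S" if "n < g" for n using that not_less_Least unfolding g_def by blast
  have finT: "finite T" using assms(1) by (simp add: T_def)
  have maya_h: "maya_h M (int m) = h m" for m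
  proof -
    have "{n. n \<notin> M \<and> n < int m} = int ` {n. n \<notin> S \<and> n < m}"
      by (auto simp: M_def image_iff) (metis nat_0_le nat_less_iff not_less zless_nat_eq_int_zless)
    then show ?thesis by (simp add: maya_h_def h_def card_image)
  qed
  have h_pos: "0 < h m \<longleftrightarrow> g < m" if "m \<in> S" for m
  proof -
    have "0 < h m \<longleftrightarrow> (\<exists>n. n \<notin> S \<and> n < m)" by (auto simp: h_def card_gt_0_iff)
    also have "\<dots> \<longleftrightarrow> g < m" using g less_g by (metis linorder_neqE_nat less_trans)
    finally show ?thesis .
  qed
  have h_neg: "maya_h M m = 0" if "m < 0" for m
  proof -
    have "{n. n \<notin> M \<and> n < m} = {}" using that by (auto simp: M_def)
    then show ?thesis by (simp only: maya_h_def card.empty)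
  qed
  have "{m \<in> M. 0 < maya_h M m} = int ` T"
  proof (intro equalityI subsetI)
    fix m assume m: "m \<in> {m \<in> M. 0 < maya_h M m}"
    then have "\<not> m < 0" using h_neg by auto
    with m obtain n where "n \<in> S" "m = int n" by (auto simp: M_def)
    with m show "m \<in> int ` T" using h_pos by (simp add: maya_h T_def)
  next
    fix m assume "m \<in> int ` T"
    then obtain n where "n \<in> S" "g < n" "m = int n" by (auto simp: T_def)
    then show "m \<in> {m \<in> M. 0 < maya_h M m}" using h_pos by (simp add: maya_h M_def[THEN eqset_imp_iff])
  qed
  moreover have "sorted_list_of_set (int ` T) = map int xs"
    using finT by (intro sorted_list_of_set_unique[THEN iffD1])
      (auto simp: xs_def sorted_wrt_map card_image)
  ultimately have lam: "lam = rev (map h xs)"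
    by (simp add: lam_def part_of_maya_def M_def[symmetric] maya_h comp_def)
  have xs: "set xs = T" "distinct xs" "sorted_wrt (<) xs" "sorted xs"
    using finT by (auto simp: xs_def)
  have h_mono: "h m \<le> h n" if "m \<le> n" for m n
    unfolding h_def using that by (intro card_mono) auto
  show "is_partition lam"
    unfolding is_partition_def lam
    using xs h_pos by (auto simp: T_def intro!: sorted_map_mono mono_onI h_mono)
  \<comment> \<open>The numbers below \<open>xs ! i\<close> are the gaps, the \<open>i\<close>
    smaller elements of \<open>T\<close>, and the initial segment of length
    \<open>g\<close>.\<close>
  have h_nth: "h (xs ! i) + i + g = xs ! i" if i: "i < length xs" for i
  proof -
    have xi: "xs ! i \<in> T" using i xs(1) by auto
    have "{m \<in> T. m < xs ! i} = (\<lambda>k. xs ! k) ` {..<i}"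
    proof (intro equalityI subsetI)
      fix m assume "m \<in> {m \<in> T. m < xs ! i}"
      then obtain k where k: "k < length xs" "m = xs ! k" "xs ! k < xs ! i"
        using xs(1) by (auto simp: in_set_conv_nth)
      then have "k < i"
        using sorted_nth_mono[OF xs(4), of i k] by (meson leD not_le_imp_less)
      then show "m \<in> (\<lambda>k. xs ! k) ` {..<i}" using k by auto
    next
      fix m assume "m \<in> (\<lambda>k. xs ! k) ` {..<i}"
      then show "m \<in> {m \<in> T. m < xs ! i}"
        using i xs(1) sorted_wrt_nth_less[OF xs(3)] by auto
    qed
    then have c: "card {m \<in> T. m < xs ! i} = i"
      using i xs(2) by (auto simp: card_image inj_on_def nth_eq_iff_index_eq)
    have "{..<xs ! i} = {n. n \<notin> S \<and> n < xs ! i} \<union> ({m \<in> T. m < xs ! i} \<union> {..<g})"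
      using xi g less_g by (auto simp: T_def) (metis linorder_neqE_nat)
    then have "xs ! i = card ({n. n \<notin> S \<and> n < xs ! i} \<union> ({m \<in> T. m < xs ! i} \<union> {..<g}))"
      by (metis card_lessThan)
    also have "\<dots> = h (xs ! i) + (card {m \<in> T. m < xs ! i} + g)"
      using finT less_g unfolding h_def
      by (subst card_Un_disjoint; auto simp: T_def card_Un_disjoint)+
    finally show ?thesis using c by simp
  qed
  have len: "length lam = length xs" by (simp add: lam)
  have deg: "g + degvec lam i = xs ! (length xs - Suc i)" if "i < length xs" for i
  proof -
    have "length xs - Suc i < length xs" using that by simp
    from h_nth[OF this] that show ?thesis by (simp add: degvec_def lam rev_nth add_ac)
  qed
  have "(\<lambda>d. g + d) ` degset lam = (\<lambda>i. xs ! (length xs - Suc i)) ` {..<length xs}"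
    unfolding degset_def image_image len using deg by (intro image_cong) auto
  also have "\<dots> = (\<lambda>i. xs ! i) ` ((\<lambda>i. length xs - Suc i) ` {..<length xs})"
    by (simp add: image_image)
  also have "(\<lambda>i. length xs - Suc i) ` {..<length xs} = {..<length xs}"
  proof (intro equalityI subsetI)
    fix m assume "m \<in> {..<length xs}"
    then show "m \<in> (\<lambda>i. length xs - Suc i) ` {..<length xs}"
      by (intro image_eqI[of _ _ "length xs - Suc m"]) auto
  qed auto
  also have "(\<lambda>i. xs ! i) ` {..<length xs} = T"
    using xs(1) by (auto simp: in_set_conv_nth)
  finally have "pad g (degset lam) = {..<g} \<union> T" by (simp add: pad_def)
  also have "\<dots> = S"
    using g less_g by (auto simp: T_def) (metis linorder_neqE_nat)
  finally show "\<exists>g. S = pad g (degset lam)" by blast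
qed

lemma shift_maya_of:
  "shift_set (maya_of lam) (int s) = {n. n < 0} \<union> int ` pad s (degset lam)"
proof -
  have "shift_set (maya_of lam) (int s) = {n. n < int s} \<union> int ` (\<lambda>d. s + d) ` degset lam"
    by (force simp: shift_set_def maya_of_def degset_def image_iff intro: exI[of _ "_ - int s"])
  also have "{n. n < int s} = {n. n < 0} \<union> int ` {..<s}"
    by (auto simp: image_iff) (metis nat_0_le nat_less_iff not_less lessThan_iff)
  finally show ?thesis by (simp add: pad_def image_Un Un_ac)
qed

lemma Phi_eq:
  "Phi mu nu (int k) = part_of_maya ({n. n < 0} \<union>
     int ` ((\<lambda>n. 2 * n) ` pad (length nu) (degset mu)
       \<union> (\<lambda>n. 2 * n + 1) ` pad (length mu + k) (degset nu)))"
proof -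
  have neg: "{n::int. n < 0} = (\<lambda>m. 2 * m) ` {n. n < 0} \<union> (\<lambda>m. 2 * m + 1) ` {n. n < 0}"
  proof (intro equalityI subsetI)
    fix n :: int assume "n \<in> {n. n < 0}"
    then have "n = 2 * (n div 2) \<and> n div 2 < 0 \<or> n = 2 * (n div 2) + 1 \<and> n div 2 < 0"
      by auto
    then show "n \<in> (\<lambda>m. 2 * m) ` {n. n < 0} \<union> (\<lambda>m. 2 * m + 1) ` {n. n < 0}" by blast
  qed auto
  have "int (length mu) + int (nat (int k)) = int (length mu + k)" by simp
  then have "Phi mu nu (int k) = part_of_maya
     ((\<lambda>m. 2 * m) ` shift_set (maya_of mu) (int (length nu))
       \<union> (\<lambda>m. 2 * m + 1) ` shift_set (maya_of nu) (int (length mu + k)))"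
    by (simp add: Phi_def Let_def image_def) (simp add: Collect_disj_eq Bex_def conj_commute)
  also have "(\<lambda>m. 2 * m) ` shift_set (maya_of mu) (int (length nu))
       \<union> (\<lambda>m. 2 * m + 1) ` shift_set (maya_of nu) (int (length mu + k))
     = {n. n < 0} \<union> int ` ((\<lambda>n. 2 * n) ` pad (length nu) (degset mu)
       \<union> (\<lambda>n. 2 * n + 1) ` pad (length mu + k) (degset nu))"
  proof -
    define P Q where "P = pad (length nu) (degset mu)" and "Q = pad (length mu + k) (degset nu)"
    have "(\<lambda>m. 2 * m) ` ({n. n < 0} \<union> int ` P) \<union> (\<lambda>m. 2 * m + 1) ` ({n. n < 0} \<union> int ` Q)
        = ((\<lambda>m. 2 * m) ` {n. n < 0} \<union> (\<lambda>m. 2 * m + 1) ` {n. n < 0})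
          \<union> ((\<lambda>m. 2 * m) ` int ` P \<union> (\<lambda>m. 2 * m + 1) ` int ` Q)"
      by (simp only: image_Un Un_ac)
    also have "\<dots> = {n. n < 0} \<union> int ` ((\<lambda>n. 2 * n) ` P \<union> (\<lambda>n. 2 * n + 1) ` Q)"
      unfolding neg[symmetric] by (simp add: image_Un image_image add.commute)
    finally show ?thesis by (simp only: shift_maya_of P_def Q_def)
  qed
  finally show ?thesis .
qed

lemma two_choose_two: "2 * int (n choose 2) = int n * (int n - 1)"
  by (induction n) (auto simp: numeral_2_eq_2 algebra_simps)

lemma Phi_properties:
  fixes k :: nat
  assumes mu: "is_partition mu" and nu: "is_partition nu"
  defines "lam \<equiv> Phi mu nu (int k)"
  defines "c \<equiv> 1 / 2 + real (length mu + k) - real (length nu)"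
  shows "is_partition lam"
    and "psize lam = k * (k + 1) div 2 + 2 * (psize mu + psize nu)"
    and "descent 0 (1 / 2) j ((\<lambda>n. real n / 2) ` degset lam)
      = descent 0 c j (spread c (degset mu) (degset nu))"
proof -
  define E where "E = pad (length nu) (degset mu)"
  define Q where "Q = pad (length mu + k) (degset nu)"
  define S where "S = (\<lambda>n. 2 * n) ` E \<union> (\<lambda>n. 2 * n + 1) ` Q"
  note fin = finite_degset[of mu] finite_degset[of nu] finite_degset[of lam]
  have finEQ: "finite E" "finite Q" using fin by (simp_all add: E_def Q_def finite_pad)
  then have finS: "finite S" by (simp add: S_def)
  have lam: "lam = part_of_maya ({n. n < 0} \<union> int ` S)"
    unfolding lam_def Phi_eq S_def E_def Q_def ..
  show part: "is_partition lam"
    unfolding lam by (rule part_of_maya(1)[OF finS])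
  obtain g where g: "S = pad g (degset lam)"
    using part_of_maya(2)[OF finS] unfolding lam by blast
  have "descent 0 (1 / 2) j ((\<lambda>n. real n / 2) ` degset lam) = descent 0 (1 / 2) j ((\<lambda>n. real n / 2) ` S)"
    unfolding g by (rule descent_pad[symmetric, OF fin(3)])
  also have "\<dots> = descent 0 c j (spread c (degset mu) (degset nu))"
    unfolding S_def E_def Q_def c_def by (rule descent_interleave[OF fin(1,2)])
  finally show "descent 0 (1 / 2) j ((\<lambda>n. real n / 2) ` degset lam)
      = descent 0 c j (spread c (degset mu) (degset nu))" .
  \<comment> \<open>The size of \<open>lam\<close> comes from computing the sum of \<open>S\<close>
    twice, by parity classes and as a padded degree set. The chosen shifts give the classes
    \<open>L\<close> and \<open>L + k\<close> elements.\<close>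
  define L where "L = length mu + length nu"
  have cE: "card E = L" using mu fin by (simp add: E_def L_def card_pad card_degset)
  have cQ: "card Q = L + k" using nu fin by (simp add: Q_def L_def card_pad card_degset)
  have disj: "(\<lambda>n. 2 * n) ` E \<inter> (\<lambda>n. 2 * n + 1) ` Q = {}" by (auto, presburger)
  have inj: "inj_on (\<lambda>n. 2 * n) E" "inj_on (\<lambda>n. 2 * n + 1) Q" by (auto simp: inj_on_def)
  have cS: "card S = 2 * L + k"
    unfolding S_def using finEQ disj inj by (simp add: card_Un_disjoint card_image cE cQ)
  have "\<Sum>S = \<Sum>((\<lambda>n. 2 * n) ` E) + \<Sum>((\<lambda>n. 2 * n + 1) ` Q)"
    unfolding S_def using finEQ disj by (intro sum.union_disjoint) auto
  also have "\<Sum>((\<lambda>n. 2 * n) ` E) = 2 * \<Sum>E"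
    by (subst sum.reindex[OF inj(1)]) (simp add: sum_distrib_left)
  also have "\<Sum>((\<lambda>n. 2 * n + 1) ` Q) = 2 * \<Sum>Q + (L + k)"
    by (subst sum.reindex[OF inj(2)]) (simp only: comp_def sum.distrib, simp add: sum_distrib_left cQ)
  finally have S: "\<Sum>S = 2 * \<Sum>E + 2 * \<Sum>Q + (L + k)" by simp
  have sE: "\<Sum>E = psize mu + (L choose 2)"
    using sum_pad[OF fin(1), of "length nu"] mu by (simp add: E_def[symmetric] cE sum_degset card_degset)
  have sQ: "\<Sum>Q = psize nu + (L + k choose 2)"
    using sum_pad[OF fin(2), of "length mu + k"] nu by (simp add: Q_def[symmetric] cQ sum_degset card_degset)
  have sS: "\<Sum>S = psize lam + (2 * L + k choose 2)"
    using sum_pad[OF fin(3), of g] part by (simp add: g[symmetric] cS sum_degset card_degset)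
  have "int (psize lam) + int (2 * L + k choose 2) = 2 * (int (psize mu) + int (L choose 2))
      + 2 * (int (psize nu) + int (L + k choose 2)) + int L + int k"
    using arg_cong[OF S, of int] unfolding sS sE sQ by simp
  \<comment> \<open>Doubling turns the binomial coefficients into products, after which
    \<open>L\<close> cancels.\<close>
  from arg_cong[OF this, of "\<lambda>x. 2 * x"]
  have "2 * int (psize lam) + 2 * int (2 * L + k choose 2) = 4 * int (psize mu)
      + 2 * (2 * int (L choose 2)) + 4 * int (psize nu) + 2 * (2 * int (L + k choose 2))
      + 2 * int L + 2 * int k" by (simp add: algebra_simps)
  then have "int (2 * psize lam) = int (k * (k + 1) + 4 * (psize mu + psize nu))"
    unfolding two_choose_two by (simp add: algebra_simps)
  then have "2 * psize lam = k * (k + 1) + 4 * (psize mu + psize nu)"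
    by (simp only: of_nat_eq_iff)
  then show "psize lam = k * (k + 1) div 2 + 2 * (psize mu + psize nu)" by simp
qed

section \<open>The coefficients of \<open>R_Phi\<close>\<close>

lemma coeff_pcompose_square:
  fixes R :: "'a::comm_semiring_1 poly"
  shows "coeff (pcompose R [:0, 0, 1:]) m = (if even m then coeff R (m div 2) else 0)"
proof (induction R arbitrary: m)
  case (pCons a R)
  show ?case
  proof (cases m rule: He.cases)
    case (3 n)
    then show ?thesis using pCons.IH[of n] by (simp add: pcompose_pCons)
  qed (simp_all add: pcompose_pCons)
qed simp

text \<open>\<open>R_Phi\<close> is a definite description, so the factorisation must be shown to
  exist and to be unique. It exists because nonzero coefficients have the parity of
  \<open>K\<close>, and those below degree \<open>K\<close> would need more than \<open>n\<close>
  descent steps, which give zero.\<close>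

lemma r_Phi_eq_descent:
  fixes k :: nat
  assumes mu: "is_partition mu" and nu: "is_partition nu" and j: "j \<le> psize mu + psize nu"
  defines "c \<equiv> 1 / 2 + real (length mu + k) - real (length nu)"
  shows "r_Phi mu nu k j = descent 0 c j (spread c (degset mu) (degset nu))"
proof -
  define n where "n = psize mu + psize nu"
  define K where "K = k * (k + 1) div 2"
  define H where "H = He_part (Phi mu nu (int k))"
  define F where "F i = descent 0 c i (spread c (degset mu) (degset nu))" for i
  note Phi = Phi_properties(1,2)[OF mu nu, of k, folded n_def K_def]
    Phi_properties(3)[OF mu nu, where k = k, folded c_def]
  have coeff_H: "coeff H m = F i" if "m + 2 * i = K + 2 * n" for m i
    unfolding H_def using coeff_He_part[OF Phi(1), of m i] Phi(2) Phi(3)[of i] that by (simp add: F_def)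
  have "c - 1 / 2 = of_int (int (length mu + k) - int (length nu))" by (simp add: c_def)
  then have "c - 1 / 2 \<in> \<int>" by (metis Ints_of_int)
  then have F_0: "F i = 0" if "n < i" for i
    unfolding F_def using that mu nu
    by (intro descent_spread_eq_0 half_int_not_Ints finite_degset)
       (auto simp: n_def sum_degset card_degset)
  have H_0: "\<exists>i\<le>n. m = K + 2 * i" if "coeff H m \<noteq> 0" for m
  proof -
    from that obtain i where i: "m + 2 * i = K + 2 * n"
      using coeff_He_part_nonzero[of "Phi mu nu (int k)" m] Phi(2) by (auto simp: H_def)
    then have "i \<le> n" using coeff_H[OF i] F_0[of i] that by (metis not_le_imp_less)
    then show ?thesis using i by (intro exI[of _ "n - i"]) auto
  qed
  define R where "R = (\<Sum>i\<le>n. monom (coeff H (K + 2 * i)) i)"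
  have "coeff R i = coeff H (K + 2 * i)" for i
    using H_0[of "K + 2 * i"] by (auto simp: R_def coeff_sum)
  then have R: "H = monom 1 K * pcompose R [:0, 0, 1:]"
    using H_0 by (intro poly_eqI) (force simp: coeff_monom_mult coeff_pcompose_square)
  have unique: "coeff R' i = coeff H (K + 2 * i)" if "H = monom 1 K * pcompose R' [:0, 0, 1:]" for R' i
    by (subst that) (simp add: coeff_monom_mult coeff_pcompose_square)
  have "R_Phi mu nu k = R"
    unfolding R_Phi_def H_def[symmetric] K_def[symmetric]
    using R unique by (intro the_equality poly_eqI) auto
  then have "r_Phi mu nu k j = coeff H (K + 2 * (n - j))"
    using unique[OF R] by (simp add: r_Phi_def n_def)
  also have "\<dots> = F j"
    using j by (intro coeff_H) (simp add: n_def)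
  finally show ?thesis by (simp add: F_def)
qed

theorem theorem4p9:
  fixes mu nu :: "nat list"
  assumes "is_partition mu" and "is_partition nu"
  shows "\<forall>j \<le> psize mu + psize nu. \<exists>P :: real poly. degree P \<le> j \<and>
           (\<forall>k :: nat. r_Phi mu nu k j = poly P (real k))"
proof (intro allI impI)
  fix j assume j: "j \<le> psize mu + psize nu"
  \<comment> \<open>The parameter of the descent is \<open>d + k\<close>, so the required polynomial
    is \<open>q\<close> after a translation, which keeps the degree.\<close>
  define d where "d = 1 / 2 + real (length mu) - real (length nu)"
  obtain q where q: "degree q \<le> j"
    "\<And>c. c - 1 / 2 \<in> \<int> \<Longrightarrow> descent 0 c j (spread c (degset mu) (degset nu)) = poly q c"
    using descent_spread_poly_degree[OF finite_degset finite_degset, of j mu nu] by blast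
  have "r_Phi mu nu k j = poly (pcompose q [:d, 1:]) (real k)" for k
  proof -
    have c: "1 / 2 + real (length mu + k) - real (length nu) = d + real k" by (simp add: d_def)
    have "d + real k - 1 / 2 = of_int (int (length mu + k) - int (length nu))" by (simp add: d_def)
    then have "d + real k - 1 / 2 \<in> \<int>" by (metis Ints_of_int)
    then show ?thesis
      using r_Phi_eq_descent[OF assms j, of k] unfolding c by (simp add: q(2) poly_pcompose)
  qed
  moreover have "degree (pcompose q [:d, 1:]) \<le> j"
    using q(1) by (simp add: degree_pcompose)
  ultimately show "\<exists>P. degree P \<le> j \<and> (\<forall>k. r_Phi mu nu k j = poly P (real k))" by blast
qed

end
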